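(* Let $\xi$ and $\xi'$ be (locally finite) Poisson point processes on $[0,\infty)$ with intensity measures $\mu$ and $\mu'$, respectively. Suppose there exists $t_0>0$ such that $\mu[0,t]\le\mu'[0,t]$ holds for all $t\le t_0$. Then, if $\xi$ yields an explosive CMJ process, so does $\xi'$. Moreover, the respective explosion times $T$ and $T'$ satisfy $$\mathbf{P}(T\ge t)\ge\mathbf{P}(T'\ge t)\quad\text{for all }t\le t_0.$$
   Context: A reproduction point process $\xi$ is a random point measure on $[0,\infty)$ that is locally finite: $\xi[0,t]<\infty$ almost surely for all $t\ge 0$. Its intensity measure is $\mu(B)=\mathbf{E}[\xi(B)]$ for Borel $B$; Poisson point processes may have atoms in their intensity measure. Write $\xi=\sum_{j=1}^N\delta_{X_j}$ with $N=\xi[0,\infty)\in\mathbb{N}_0\cup\{\infty\}$ and $X_j=\inf\{t\ge 0:\xi[0,t]\ge j\}$ ($\inf\varnothing=\infty$). Crump-Mode-Jagers (CMJ) process driven by $\xi$: let $\mathcal{I}=\{\varnothing\}\cup\bigcup_{n\in\mathbb{N}}\mathbb{N}^n$ be the set of labels, and let $(\xi_u)_{u\in\mathcal{I}}$ be i.i.d. copies of $\xi$, with $X_{u,j}$ defined from $\xi_u$ as $X_j$ is from $\xi$. Birth times are $S(\varnothing)=0$ and $S(uj)=S(u)+X_{u,j}$ for $u\in\mathcal{I}$, $j\in\mathbb{N}$ (individuals with $S(u)=\infty$ are never born). Let $\mathcal{Z}_t=\#\{u\in\mathcal{I}:S(u)\le t\}$ and let $T=\inf\{t\ge 0:\mathcal{Z}_t=\infty\}\in[0,\infty]$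 be the explosion time. One says that $\xi$ yields an explosive CMJ process if $\mathbf{P}(T<\infty)>0$. *)

theory Defs
  imports "HOL-Probability.Probability"
begin

section \<open>Random point measures on the half-line\<close>

abbreviation half_line :: "real measure" where
  "half_line \<equiv> restrict_space borel {0..}"

text \<open>
  A point measure is a countable sum of unit masses \<open>\<Sum>j\<in>J. \<delta>\<^sub>x\<^sub>j\<close>, written here as the image of
  counting measure on \<open>J\<close> under \<open>x\<close>; repetitions in \<open>x\<close> give multiple points.
\<close>
definition point_measure_on_half_line :: "real measure \<Rightarrow> bool" where
  "point_measure_on_half_line \<nu> \<longleftrightarrow>
     (\<exists>(J :: nat set) x. x \<in> J \<rightarrow> {0..} \<and> \<nu> = distr (count_space J) half_line x)"

text \<open>
  The space of point measures carries the sigma-algebra generated by all evaluations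
  \<open>\<nu> \<mapsto> \<nu> B\<close>, as \<^const>\<open>subprob_algebra\<close> does for subprobability measures.
\<close>
definition point_measures :: "real measure measure" where
  "point_measures =
     (SUP B \<in> sets half_line.
        vimage_algebra {\<nu>. point_measure_on_half_line \<nu>} (\<lambda>\<nu>. emeasure \<nu> B) borel)"

lemma space_point_measures: "space point_measures = {\<nu>. point_measure_on_half_line \<nu>}"
  by (auto simp: point_measures_def space_Sup_eq_UN)

lemma measurable_emeasure_point_measures:
  "B \<in> sets half_line \<Longrightarrow> (\<lambda>\<nu>. emeasure \<nu> B) \<in> borel_measurable point_measures"
  by (auto intro!: measurable_Sup1 measurable_vimage_algebra1 simp: point_measures_def)

definition point_process :: "'a measure \<Rightarrow> ('a \<Rightarrow> real measure) \<Rightarrow> bool" where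
  "point_process P \<xi> \<longleftrightarrow> prob_space P \<and> \<xi> \<in> measurable P point_measures"

definition reproduction_point_process :: "'a measure \<Rightarrow> ('a \<Rightarrow> real measure) \<Rightarrow> bool" where
  "reproduction_point_process P \<xi> \<longleftrightarrow>
     point_process P \<xi> \<and> (\<forall>t\<ge>0. AE \<omega> in P. emeasure (\<xi> \<omega>) {0..t} < \<infinity>)"

definition intensity_measure :: "'a measure \<Rightarrow> ('a \<Rightarrow> real measure) \<Rightarrow> real measure" where
  "intensity_measure P \<xi> =
     measure_of {0..} (sets half_line) (\<lambda>B. \<integral>\<^sup>+\<omega>. emeasure (\<xi> \<omega>) B \<partial>P)"

lemma emeasure_intensity_measure:
  assumes "point_process P \<xi>" and "B \<in> sets half_line"
  shows "emeasure (intensity_measure P \<xi>) B = (\<integral>\<^sup>+\<omega>. emeasure (\<xi> \<omega>) B \<partial>P)"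
proof -
  have xi: "\<xi> \<in> measurable P point_measures"
    using assms(1) by (simp add: point_process_def)
  have sets_xi: "sets (\<xi> \<omega>) = sets half_line" if "\<omega> \<in> space P" for \<omega>
    using measurable_space[OF xi that]
    by (auto simp: space_point_measures point_measure_on_half_line_def)
  have meas: "(\<lambda>\<omega>. emeasure (\<xi> \<omega>) A) \<in> borel_measurable P" if "A \<in> sets half_line" for A
    using measurable_compose[OF xi measurable_emeasure_point_measures[OF that]] .
  let ?f = "\<lambda>B. \<integral>\<^sup>+\<omega>. emeasure (\<xi> \<omega>) B \<partial>P"
  have ca: "countably_additive (sets half_line) ?f"
  proof (rule countably_additiveI)
    fix A :: "nat \<Rightarrow> real set"
    assume A: "range A \<subseteq> sets half_line" "disjoint_family A"
    have "(\<Sum>i. ?f (A i)) = (\<integral>\<^sup>+\<omega>. (\<Sum>i. emeasure (\<xi> \<omega>) (A i)) \<partial>P)"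
      using A(1) by (intro nn_integral_suminf[symmetric] meas) auto
    also have "\<dots> = ?f (\<Union>i. A i)"
      using A by (intro nn_integral_cong suminf_emeasure) (auto simp: sets_xi)
    finally show "(\<Sum>i. ?f (A i)) = ?f (\<Union>i. A i)" .
  qed
  have "sigma_algebra {0..} (sets half_line)"
    using sets.sigma_algebra_axioms[of half_line] by (simp add: space_restrict_space)
  then show ?thesis
    unfolding intensity_measure_def using assms(2) ca
    by (intro emeasure_measure_of_sigma) (auto simp: positive_def)
qed

text \<open>
  The mass \<open>\<mu> B\<close> may be 0, which the library's \<open>poisson_pmf\<close> excludes; the formula below then gives
  the point mass at 0, since \<open>0 ^ 0 = 1\<close>. Mean \<open>\<infinity>\<close> corresponds to the constant \<open>\<infinity>\<close>. There is no
  diffuseness assumption, so \<open>\<mu>\<close> may have atoms.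
\<close>
definition poisson_point_process ::
    "'a measure \<Rightarrow> ('a \<Rightarrow> real measure) \<Rightarrow> real measure \<Rightarrow> bool" where
  "poisson_point_process P \<xi> \<mu> \<longleftrightarrow>
     point_process P \<xi> \<and>
     \<mu> = intensity_measure P \<xi> \<and>
     (\<forall>B\<in>sets half_line. emeasure \<mu> B < \<infinity> \<longrightarrow>
        (\<forall>k::nat. \<P>(\<omega> in P. emeasure (\<xi> \<omega>) B = of_nat k)
           = measure \<mu> B ^ k / fact k * exp (- measure \<mu> B))) \<and>
     (\<forall>B\<in>sets half_line. emeasure \<mu> B = \<infinity> \<longrightarrow> (AE \<omega> in P. emeasure (\<xi> \<omega>) B = \<infinity>)) \<and>
     (\<forall>(n::nat) B. (\<forall>i<n. B i \<in> sets half_line) \<and> disjoint_family_on B {..<n} \<longrightarrow>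
        prob_space.indep_vars P (\<lambda>_. borel) (\<lambda>i \<omega>. emeasure (\<xi> \<omega>) (B i)) {..<n})"

section \<open>Crump-Mode-Jagers processes\<close>

text \<open>
  For \<open>j \<ge> 1\<close>, the position of the \<open>j\<close>-th point of \<open>\<nu>\<close>; it is \<open>\<infinity>\<close> if there are fewer than \<open>j\<close>.
\<close>
definition nth_point :: "real measure \<Rightarrow> nat \<Rightarrow> ereal" where
  "nth_point \<nu> j = Inf (ereal ` {t. 0 \<le> t \<and> emeasure \<nu> {0..t} \<ge> of_nat j})"

text \<open>
  Labels are finite words over the positive integers, stored with the youngest generation first:
  the \<open>j\<close>-th child of \<open>u\<close> is \<open>j # u\<close>.
\<close>
definition labels :: "nat list set" where
  "labels = lists {1..}"

primrec birth_time :: "(nat list \<Rightarrow> real measure) \<Rightarrow> nat list \<Rightarrow> ereal" where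
  "birth_time x [] = 0"
| "birth_time x (j # u) = birth_time x u + nth_point (x u) j"

definition born_by :: "(nat list \<Rightarrow> real measure) \<Rightarrow> real \<Rightarrow> nat list set" where
  "born_by x t = {u \<in> labels. birth_time x u \<le> ereal t}"

definition explosion_time :: "(nat list \<Rightarrow> real measure) \<Rightarrow> ereal" where
  "explosion_time x = Inf (ereal ` {t. 0 \<le> t \<and> infinite (born_by x t)})"

definition iid_copies ::
    "'b measure \<Rightarrow> (nat list \<Rightarrow> 'b \<Rightarrow> real measure) \<Rightarrow> 'a measure \<Rightarrow> ('a \<Rightarrow> real measure) \<Rightarrow> bool" where
  "iid_copies M \<Xi> P \<xi> \<longleftrightarrow>
     prob_space M \<and>
     prob_space.indep_vars M (\<lambda>_. point_measures) \<Xi> labels \<and>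
     (\<forall>u\<in>labels. distr M point_measures (\<Xi> u) = distr P point_measures \<xi>)"

abbreviation cmj_explosion_time :: "(nat list \<Rightarrow> 'b \<Rightarrow> real measure) \<Rightarrow> 'b \<Rightarrow> ereal" where
  "cmj_explosion_time \<Xi> \<omega> \<equiv> explosion_time (\<lambda>u. \<Xi> u \<omega>)"

definition explosive_cmj :: "'b measure \<Rightarrow> (nat list \<Rightarrow> 'b \<Rightarrow> real measure) \<Rightarrow> bool" where
  "explosive_cmj M \<Xi> \<longleftrightarrow> \<P>(\<omega> in M. cmj_explosion_time \<Xi> \<omega> < \<infinity>) > 0"

end

theory Submission
  imports Defs
begin

text \<open>
  Both processes are built from one Poisson process with unit rate: if \<open>N a\<close> counts its points in
  \<open>[0, a]\<close>, then \<open>(N (\<mu> [0, t]))\<^sub>t\<close> has the law of \<open>(\<xi> [0, t])\<^sub>t\<close>, with or without atoms in \<open>\<mu>\<close>. As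
  \<open>\<mu> [0, t] \<le> \<mu>' [0, t]\<close> up to \<open>t\<^sub>0\<close>, every child born before age \<open>t\<^sub>0\<close> is born no later in the second
  process. Coupling the labels independently in this way turns every explosion before \<open>t \<le> t\<^sub>0\<close> of
  the first process into one of the second.

  For the explosiveness it remains to see that an explosive process explodes before \<open>t\<^sub>0\<close> with positive
  probability. Otherwise almost surely the descendants of every individual are finitely many up to
  age \<open>t\<^sub>0 / 2\<close>, and by local finiteness this propagates to the ages \<open>n t\<^sub>0 / 2\<close>.
\<close>

section \<open>Explosion as a monotone functional of the birth ages\<close>

text \<open>The given families live on unrelated probability spaces, so the coupling can only be
  made through laws: the event T < t has to be expressed by countably many counts whose joint law is
  the same for the given process and for the constructed one. Counts at rational times below
  \<open>t0\<close> do this, because displacements are nonnegative and a birth before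
  \<open>t0\<close> therefore involves only displacements below \<open>t0\<close>. The levels
  \<mu>[0,q] with q < \<open>t0\<close> are bounded, so the unit-rate process is built only on an
  interval [0,m], as a Poisson(m) number of independent uniform points. An atom of mass a is a jump
  of length a of the level: all points of the unit-rate process in the jumped interval, Poisson(a)
  many, are placed at the atom. This is why atoms cause no difficulty.\<close>

primrec birth :: "(nat list \<Rightarrow> nat \<Rightarrow> ereal) \<Rightarrow> nat list \<Rightarrow> ereal" where
  "birth p [] = 0"
| "birth p (j # u) = birth p u + p u j"

text \<open>The argument \<open>p\<close> holds the ages at which children are born instead of the
  measures, so that true point positions and positions read off from counts can both be inserted.
  The strict \<open>s<t\<close> describes T < t, whether or not the infimum T is attained.\<close>

definition explodes_before :: "(nat list \<Rightarrow> nat \<Rightarrow> ereal) \<Rightarrow> real \<Rightarrow> bool" where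
  "explodes_before p t \<longleftrightarrow> (\<exists>s<t. infinite {u \<in> labels. birth p u \<le> ereal s})"

lemma Cons_in_labels [simp]: "j # u \<in> labels \<longleftrightarrow> 1 \<le> j \<and> u \<in> labels"
  by (simp add: labels_def)

lemma Nil_in_labels [simp]: "[] \<in> labels"
  by (simp add: labels_def)

lemma append_in_labels [simp]: "u @ v \<in> labels \<longleftrightarrow> u \<in> labels \<and> v \<in> labels"
  by (auto simp: labels_def)

lemma birth_nonneg:
  assumes "\<And>u j. 0 \<le> p u j"
  shows "0 \<le> birth p u"
  by (induction u) (auto intro: add_nonneg_nonneg assms)

text \<open>All displacements along the line of \<open>u\<close> are nonnegative, so each is at most
  the birth time and hence below \<open>t0\<close>, where the comparison is available.\<close>

lemma birth_le_birth:
  assumes nn: "\<And>u j. 0 \<le> p u j"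
    and le: "\<And>u j. u \<in> labels \<Longrightarrow> 1 \<le> j \<Longrightarrow> p u j < ereal t0 \<Longrightarrow> p' u j \<le> p u j"
    and "u \<in> labels" "birth p u < ereal t0"
  shows "birth p' u \<le> birth p u"
  using assms(3,4)
proof (induction u)
  case (Cons j u)
  have "birth p u \<le> birth p u + p u j" "p u j \<le> birth p u + p u j"
    using nn[of u j] birth_nonneg[of p u, OF nn] by (auto intro: add_increasing add_increasing2)
  with Cons.prems have "birth p u < ereal t0" "p u j < ereal t0"
    by auto
  then show ?case
    using Cons le by (auto intro!: add_mono)
qed simp

lemma explodes_before_mono:
  assumes nn: "\<And>u j. 0 \<le> p u j"
    and le: "\<And>u j. u \<in> labels \<Longrightarrow> 1 \<le> j \<Longrightarrow> p u j < ereal t0 \<Longrightarrow> p' u j \<le> p u j"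
    and "t \<le> t0" "explodes_before p t"
  shows "explodes_before p' t"
proof -
  from assms(4) obtain s where s: "s < t" "infinite {u \<in> labels. birth p u \<le> ereal s}"
    by (auto simp: explodes_before_def)
  have "birth p' u \<le> ereal s" if "u \<in> labels" "birth p u \<le> ereal s" for u
  proof -
    have "birth p u < ereal t0"
      using that(2) s(1) assms(3) by (auto intro: le_less_trans)
    from birth_le_birth[OF nn le that(1) this] that(2) show ?thesis
      by auto
  qed
  then have "{u \<in> labels. birth p u \<le> ereal s} \<subseteq> {u \<in> labels. birth p' u \<le> ereal s}"
    by auto
  with s show ?thesis
    unfolding explodes_before_def by (meson finite_subset)
qed

text \<open>This form has countable quantifiers only, as measurability requires: the sets of born
  labels grow with \<open>s\<close>, so rational bounds suffice, and a set of labels is infinite iff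
  its codes are unbounded.\<close>

lemma explodes_before_iff_rat:
  "explodes_before p t \<longleftrightarrow>
    (\<exists>r::rat. of_rat r < t \<and> (\<forall>n. \<exists>u. n \<le> to_nat u \<and> u \<in> labels \<and> birth p u \<le> ereal (of_rat r)))"
proof -
  have inf: "infinite A \<longleftrightarrow> (\<forall>n. \<exists>u. n \<le> to_nat u \<and> u \<in> A)" for A :: "nat list set"
  proof -
    have "finite A \<longleftrightarrow> finite (to_nat ` A)"
      by (metis finite_imageI finite_imageD inj_on_subset inj_to_nat subset_UNIV)
    then have "infinite A \<longleftrightarrow> (\<forall>n. \<exists>m\<ge>n. m \<in> to_nat ` A)"
      by (simp only: infinite_nat_iff_unbounded_le)
    then show ?thesis by blast
  qed
  show ?thesis
  proof
    assume "explodes_before p t"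
    then obtain s where s: "s < t" "infinite {u \<in> labels. birth p u \<le> ereal s}"
      by (auto simp: explodes_before_def)
    obtain r where r: "s < of_rat r" "of_rat r < t"
      using of_rat_dense[OF s(1)] by blast
    have "{u \<in> labels. birth p u \<le> ereal s} \<subseteq> {u \<in> labels. birth p u \<le> ereal (of_rat r)}"
      using r by (auto intro: order_trans)
    with s(2) have "infinite {u \<in> labels. birth p u \<le> ereal (of_rat r)}"
      by (meson finite_subset)
    then show "\<exists>r::rat. of_rat r < t \<and> (\<forall>n. \<exists>u. n \<le> to_nat u \<and> u \<in> labels \<and> birth p u \<le> ereal (of_rat r))"
      using r(2) unfolding inf by auto
  next
    assume "\<exists>r::rat. of_rat r < t \<and> (\<forall>n. \<exists>u. n \<le> to_nat u \<and> u \<in> labels \<and> birth p u \<le> ereal (of_rat r))"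
    then obtain r :: rat where r: "of_rat r < t"
      "\<forall>n. \<exists>u. n \<le> to_nat u \<and> u \<in> {u \<in> labels. birth p u \<le> ereal (of_rat r)}"
      by auto
    then show "explodes_before p t"
      unfolding explodes_before_def inf[symmetric] by blast
  qed
qed

lemma birth_measurable:
  assumes "\<And>u j. u \<in> labels \<Longrightarrow> (\<lambda>\<omega>. p \<omega> u j) \<in> borel_measurable M" and "u \<in> labels"
  shows "(\<lambda>\<omega>. birth (p \<omega>) u) \<in> borel_measurable M"
  using assms(2) by (induction u) (auto intro!: borel_measurable_ereal_add assms(1))

lemma explodes_before_measurable:
  assumes [measurable]: "\<And>u j. u \<in> labels \<Longrightarrow> (\<lambda>\<omega>. p \<omega> u j) \<in> borel_measurable M"
  shows "Measurable.pred M (\<lambda>\<omega>. explodes_before (p \<omega>) t)"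
proof -
  have [measurable]: "Measurable.pred M (\<lambda>\<omega>. u \<in> labels \<and> birth (p \<omega>) u \<le> ereal s)" for u s
  proof (cases "u \<in> labels")
    case True
    note [measurable] = birth_measurable[where p=p, OF assms True]
    show ?thesis by measurable
  qed simp
  show ?thesis
    unfolding explodes_before_iff_rat by measurable
qed

section \<open>Explosion times in terms of \<open>explodes_before\<close>\<close>

lemma birth_time_eq_birth: "birth_time x u = birth (\<lambda>u. nth_point (x u)) u"
  by (induction u) auto

lemma nth_point_nonneg: "0 \<le> nth_point \<nu> j"
  unfolding nth_point_def by (auto intro: Inf_greatest)

lemma explosion_time_less_iff:
  "explosion_time x < ereal t \<longleftrightarrow> explodes_before (\<lambda>u. nth_point (x u)) t"
proof -
  \<comment> \<open>The infimum in \<open>explosion_time\<close> runs over nonnegative times; at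
    negative times nobody is born.\<close>
  have "0 \<le> s" if "infinite (born_by x s)" for s
  proof -
    from that have "born_by x s \<noteq> {}" by auto
    then obtain u where "birth_time x u \<le> ereal s"
      by (auto simp: born_by_def)
    moreover have "0 \<le> birth_time x u"
      unfolding birth_time_eq_birth by (intro birth_nonneg nth_point_nonneg)
    ultimately have "0 \<le> ereal s" by (rule order_trans[rotated])
    then show ?thesis by simp
  qed
  then have "explosion_time x < ereal t \<longleftrightarrow> (\<exists>s<t. infinite (born_by x s))"
    unfolding explosion_time_def Inf_less_iff by auto
  then show ?thesis
    by (simp add: explodes_before_def born_by_def birth_time_eq_birth)
qed

section \<open>Propagation of finiteness from a short age to its multiples\<close>

lemma birth_time_append: "birth_time x (v @ u) = birth_time x u + birth_time (\<lambda>w. x (w @ u)) v"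
  by (induction v) (auto simp: add.assoc)

text \<open>Of the time (n + 1) s, at most n s is left in the subtree of an individual born after
  \<open>s\<close>. The induction hypothesis is applied to that subtree, which is why the root
  \<open>u\<close> varies in the induction. The assumption \<open>fin\<close> leaves finitely many
  parents born by \<open>s\<close>, and \<open>loc\<close> finitely many children of each.\<close>

lemma finite_born_by_multiple:
  assumes s: "0 < s"
    and fin: "\<And>u. u \<in> labels \<Longrightarrow> finite (born_by (\<lambda>v. x (v @ u)) s)"
    and loc: "\<And>u t. u \<in> labels \<Longrightarrow> finite {j. nth_point (x u) j \<le> ereal t}"
    and "u \<in> labels"
  shows "finite (born_by (\<lambda>v. x (v @ u)) (real n * s))"
  using assms(4)
proof (induction n arbitrary: u)
  case 0
  have "born_by (\<lambda>v. x (v @ u)) 0 \<subseteq> born_by (\<lambda>v. x (v @ u)) s"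
    using s by (auto simp: born_by_def zero_ereal_def intro: order_trans)
  then show ?case
    using fin[OF 0] finite_subset by auto
next
  case (Suc n)
  \<comment> \<open>A late individual descends from the first late individual \<open>j # w\<close> of its line; its parent \<open>w\<close> is
    one of finitely many.\<close>
  define y where "y = (\<lambda>v. x (v @ u))"
  define t where "t = real (Suc n) * s"
  define A where "A = born_by y s"
  define J where "J = (\<lambda>w. {j. 1 \<le> j \<and> nth_point (y w) j \<le> ereal t})"
  have nn: "0 \<le> birth_time z w" for z w
    unfolding birth_time_eq_birth by (intro birth_nonneg nth_point_nonneg)
  \<comment> \<open>The youngest member is the head of the list, so each induction step adds one
    generation: a late \<open>j # v\<close> either has its parent in \<open>A\<close> and is itself
    the first late individual, or inherits the one found for \<open>v\<close>.\<close>
  have split: "v \<in> A \<or> (\<exists>w j v'. w \<in> A \<and> j \<in> J w \<and> v = v' @ j # w \<and> ereal s < birth_time y (j # w))"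
    if "v \<in> labels" "birth_time y v \<le> ereal t" for v
    using that
  proof (induction v)
    case Nil
    then show ?case using s by (auto simp: A_def born_by_def)
  next
    case (Cons j v)
    have "birth_time y v \<le> birth_time y v + nth_point (y v) j"
      "nth_point (y v) j \<le> birth_time y v + nth_point (y v) j"
      using nn[of y v] nth_point_nonneg[of "y v" j] by (auto intro: add_increasing add_increasing2)
    with Cons.prems have le: "birth_time y v \<le> ereal t" "nth_point (y v) j \<le> ereal t"
      by auto
    from Cons.IH le Cons.prems consider "v \<in> A" |
      "\<exists>w i v'. w \<in> A \<and> i \<in> J w \<and> v = v' @ i # w \<and> ereal s < birth_time y (i # w)" by auto
    then show ?case
    proof cases
      case 1
      show ?thesis
      proof (cases "birth_time y (j # v) \<le> ereal s")
        case True
        then show ?thesis using Cons.prems by (auto simp: A_def born_by_def)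
      next
        case False
        have "j \<in> J v" using le Cons.prems by (auto simp: J_def)
        moreover have "ereal s < birth_time y (j # v)" using False by auto
        ultimately show ?thesis using 1 by (metis append_Nil)
      qed
    next
      case 2
      then show ?thesis by (metis append_Cons)
    qed
  qed
  have "born_by y t \<subseteq> A \<union> (\<Union>w\<in>A. \<Union>j\<in>J w. (\<lambda>v. v @ j # w) ` born_by (\<lambda>v. x (v @ (j # w) @ u)) (real n * s))"
  proof
    fix v assume "v \<in> born_by y t"
    then have v: "v \<in> labels" "birth_time y v \<le> ereal t" by (auto simp: born_by_def)
    from split[OF v] show "v \<in> A \<union> (\<Union>w\<in>A. \<Union>j\<in>J w. (\<lambda>v. v @ j # w) ` born_by (\<lambda>v. x (v @ (j # w) @ u)) (real n * s))"
    proof (elim disjE exE conjE)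
      fix w j v' assume w: "w \<in> A" "j \<in> J w" "v = v' @ j # w" "ereal s < birth_time y (j # w)"
      have "birth_time y (j # w) + birth_time (\<lambda>v. y (v @ (j # w))) v' \<le> ereal t"
        using v(2) w(3) by (simp only: birth_time_append)
      then have "birth_time (\<lambda>v. y (v @ (j # w))) v' \<le> ereal (real n * s)"
        using w(4) nn[of "\<lambda>v. y (v @ (j # w))" v']
        by (cases "birth_time y (j # w)"; cases "birth_time (\<lambda>v. y (v @ (j # w))) v'")
           (auto simp: t_def algebra_simps simp del: birth_time.simps)
      then have "v' \<in> born_by (\<lambda>v. x (v @ (j # w) @ u)) (real n * s)"
        using v w by (auto simp: born_by_def y_def)
      then show ?thesis using w by blast
    qed simp
  qed
  moreover have "finite A"
    using fin[OF Suc.prems] by (simp add: A_def y_def)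
  moreover have "finite (J w)" if "w \<in> A" for w
  proof -
    have "w @ u \<in> labels" using that Suc.prems by (auto simp: A_def born_by_def)
    from loc[OF this, of t] show ?thesis
      by (rule finite_subset[rotated]) (auto simp: J_def y_def)
  qed
  moreover have "finite (born_by (\<lambda>v. x (v @ (j # w) @ u)) (real n * s))" if "w \<in> A" "j \<in> J w" for w j
    using Suc.IH[of "(j # w) @ u"] that Suc.prems by (auto simp: A_def born_by_def J_def)
  ultimately have "finite (born_by y t)"
    by (auto intro: finite_subset)
  then show ?case
    by (simp only: y_def t_def)
qed

section \<open>Point positions as functions of countably many counts\<close>

text \<open>
  The point positions read off from the counts at countably many times, so that only countably many
  real random variables enter the coupling. With the times restricted to \<open>rats_below b\<close>, points at or
  beyond \<open>b\<close> may be moved.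
\<close>
definition count_point :: "real set \<Rightarrow> (real \<Rightarrow> ennreal) \<Rightarrow> nat \<Rightarrow> ereal" where
  "count_point Q c j = (INF q\<in>Q. if of_nat j \<le> c q then ereal q else \<infinity>)"

abbreviation rats_below :: "ereal \<Rightarrow> real set" where
  "rats_below b \<equiv> {q \<in> \<rat>. 0 \<le> q \<and> ereal q < b}"

lemma countable_rats_below: "countable (rats_below b)"
  by (rule countable_subset[OF _ countable_rat]) auto

lemma atLeastAtMost_in_half_line: "{0..q} \<in> sets half_line"
  by (auto simp: sets_restrict_space_iff)

lemma sets_point_measure:
  "\<nu> \<in> space point_measures \<Longrightarrow> sets \<nu> = sets half_line"
  by (auto simp: space_point_measures point_measure_on_half_line_def)

lemma count_point_nonneg: "Q \<subseteq> {0..} \<Longrightarrow> 0 \<le> count_point Q c j"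
  unfolding count_point_def by (rule INF_greatest) auto

lemma count_point_antimono:
  "(\<And>q. q \<in> Q \<Longrightarrow> c q \<le> c' q) \<Longrightarrow> count_point Q c' j \<le> count_point Q c j"
  unfolding count_point_def by (rule INF_mono) (force intro: order_trans)

text \<open>An infimum over fewer times can only be larger.\<close>

lemma nth_point_le_count_point:
  "nth_point \<nu> j \<le> count_point (rats_below b) (\<lambda>q. emeasure \<nu> {0..q}) j"
  unfolding count_point_def nth_point_def by (rule INF_greatest) (auto intro!: Inf_lower)

text \<open>Counts increase with time, so a rational shortly after a witness for
  \<open>nth_point\<close> is again a witness; if the position lies below \<open>b\<close>, this
  rational can be chosen below \<open>b\<close> as well.\<close>

lemma count_point_le_nth_point:
  assumes "\<nu> \<in> space point_measures" "nth_point \<nu> j < b"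
  shows "count_point (rats_below b) (\<lambda>q. emeasure \<nu> {0..q}) j \<le> nth_point \<nu> j"
proof (rule dense_ge)
  fix y assume "nth_point \<nu> j < y"
  with assms have "nth_point \<nu> j < min b y" by simp
  then obtain s where s: "0 \<le> s" "of_nat j \<le> emeasure \<nu> {0..s}" "ereal s < min b y"
    unfolding nth_point_def Inf_less_iff by auto
  obtain z where z: "ereal s < ereal z" "ereal z < min b y"
    using ereal_dense2[OF s(3)] by auto
  then obtain q where q: "q \<in> \<rat>" "s < q" "q < z"
    using Rats_dense_in_real[of s z] by auto
  have "emeasure \<nu> {0..s} \<le> emeasure \<nu> {0..q}"
    using q atLeastAtMost_in_half_line by (intro emeasure_mono) (auto simp: sets_point_measure[OF assms(1)])
  moreover have qz: "ereal q < ereal z" using q by simp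
  from less_trans[OF qz z(2)] have "ereal q < b" "ereal q < y" by auto
  ultimately show "count_point (rats_below b) (\<lambda>q. emeasure \<nu> {0..q}) j \<le> y"
    unfolding count_point_def using q s by (intro INF_lower2[of q]) (auto intro: order_trans)
qed

lemma nth_point_eq_count_point:
  assumes "\<nu> \<in> space point_measures"
  shows "nth_point \<nu> j = count_point (rats_below \<infinity>) (\<lambda>q. emeasure \<nu> {0..q}) j"
  using nth_point_le_count_point[of \<nu> j \<infinity>] count_point_le_nth_point[OF assms, of j \<infinity>]
  by (cases "nth_point \<nu> j = \<infinity>") (auto intro: antisym)

lemma count_point_measurable:
  assumes [measurable]: "\<And>q. q \<in> Q \<Longrightarrow> (\<lambda>\<omega>. c \<omega> q) \<in> borel_measurable M" and "countable Q"
  shows "(\<lambda>\<omega>. count_point Q (c \<omega>) j) \<in> borel_measurable M"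
  unfolding count_point_def using assms(2) by measurable

lemma nth_point_measurable [measurable]:
  "(\<lambda>\<nu>. nth_point \<nu> j) \<in> borel_measurable point_measures"
proof -
  have "(\<lambda>\<nu>. count_point (rats_below \<infinity>) (\<lambda>q. emeasure \<nu> {0..q}) j) \<in> borel_measurable point_measures"
    by (intro count_point_measurable countable_rats_below measurable_emeasure_point_measures
        atLeastAtMost_in_half_line)
  then show ?thesis
    by (rule measurable_cong[THEN iffD1, rotated]) (simp add: nth_point_eq_count_point)
qed

lemma finite_nth_point_le:
  assumes "\<nu> \<in> space point_measures" and fin: "\<And>n::nat. emeasure \<nu> {0..real n} < \<infinity>"
  shows "finite {j. nth_point \<nu> j \<le> ereal t}"
proof -
  \<comment> \<open>An integer strictly above \<open>t\<close> turns the bound on the infimum into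
    an actual time \<open>s < real n\<close> with count at least \<open>j\<close>, so the count up
    to \<open>real n\<close> bounds \<open>j\<close>.\<close>
  obtain n :: nat where n: "t < real n" using reals_Archimedean2 by blast
  obtain k :: nat where k: "emeasure \<nu> {0..real n} < of_nat k"
    using fin[of n] ennreal_Ex_less_of_nat by (auto simp: less_top)
  have "j \<le> k" if "nth_point \<nu> j \<le> ereal t" for j
  proof -
    have "nth_point \<nu> j < ereal (real n)" using that n by (auto intro: le_less_trans)
    then obtain s where s: "of_nat j \<le> emeasure \<nu> {0..s}" "s < real n"
      unfolding nth_point_def Inf_less_iff by auto
    have "emeasure \<nu> {0..s} \<le> emeasure \<nu> {0..real n}"
      using s atLeastAtMost_in_half_line by (intro emeasure_mono) (auto simp: sets_point_measure[OF assms(1)])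
    with s k have "of_nat j < (of_nat k :: ennreal)" by (meson le_less_trans)
    then have "j < k" by (simp only: of_nat_less_iff)
    then show ?thesis by simp
  qed
  then have "{j. nth_point \<nu> j \<le> ereal t} \<subseteq> {..k}" by auto
  then show ?thesis by (rule finite_subset) simp
qed
section \<open>Poisson samples\<close>

definition point_count :: "'a set \<Rightarrow> nat \<Rightarrow> (nat \<Rightarrow> 'a) \<Rightarrow> nat" where
  "point_count B k x = (\<Sum>j<k. indicator B (x j))"

lemma point_count_measurable [measurable]:
  assumes [measurable]: "B \<in> sets R"
  shows "point_count B k \<in> measurable (Pi\<^sub>M UNIV (\<lambda>_. R)) (count_space UNIV)"
  unfolding point_count_def indicator_def by measurable

lemma point_count_mono: "B \<subseteq> C \<Longrightarrow> point_count B k x \<le> point_count C k x"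
  unfolding point_count_def by (intro sum_mono) (auto simp: indicator_def)

lemma sum_indicator_le_1:
  assumes "finite I" "disjoint_family_on B I"
  shows "(\<Sum>i\<in>I. indicator (B i) y :: nat) \<le> 1"
  unfolding indicator_UN_disjoint[OF assms, symmetric] by (simp add: indicator_def)

lemma sum_point_count_le:
  assumes "finite I" "disjoint_family_on B I"
  shows "(\<Sum>i\<in>I. point_count (B i) k x) \<le> k"
proof -
  have "(\<Sum>i\<in>I. point_count (B i) k x) = (\<Sum>j<k. \<Sum>i\<in>I. indicator (B i) (x j))"
    unfolding point_count_def by (rule sum.swap)
  also have "\<dots> \<le> (\<Sum>j<k. 1)"
    by (intro sum_mono sum_indicator_le_1 assms)
  finally show ?thesis by simp
qed

text \<open>The joint law of the projections is the product measure itself, which is the criterion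
  for independence.\<close>

lemma indep_vars_PiM_component:
  assumes "I \<noteq> {}" "\<And>i. i \<in> I \<Longrightarrow> prob_space (M i)"
  shows "prob_space.indep_vars (Pi\<^sub>M I M) M (\<lambda>i \<omega>. \<omega> i) I"
proof -
  interpret prob_space "Pi\<^sub>M I M" by (intro prob_space_PiM assms)
  have "distr (Pi\<^sub>M I M) (Pi\<^sub>M I M) (\<lambda>x. \<lambda>i\<in>I. x i) = distr (Pi\<^sub>M I M) (Pi\<^sub>M I M) (\<lambda>x. x)"
    by (rule distr_cong) (auto simp: space_PiM)
  also have "\<dots> = Pi\<^sub>M I (\<lambda>i. distr (Pi\<^sub>M I M) (M i) (\<lambda>\<omega>. \<omega> i))"
    unfolding distr_id
  proof (rule PiM_cong[OF refl])
    fix i assume "i \<in> I"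
    with assms(2) show "M i = distr (Pi\<^sub>M I M) (M i) (\<lambda>\<omega>. \<omega> i)"
      by (intro distr_PiM_component[symmetric])
  qed
  finally show ?thesis
    using assms(1) by (subst indep_vars_iff_distr_eq_PiM') auto
qed

text \<open>The multinomial law. As the prescribed counts add up to the number of points, every
  point must fall into one of the cells, even if these do not cover the space. The induction splits
  according to the cell of the last point.\<close>

lemma prob_point_counts:
  assumes R: "prob_space R" and I: "finite I" "disjoint_family_on B I"
    and B [measurable]: "\<And>i. i \<in> I \<Longrightarrow> B i \<in> sets R"
    and "(\<Sum>i\<in>I. \<kappa> i) = k"
  shows "measure (Pi\<^sub>M UNIV (\<lambda>_. R)) {x \<in> space (Pi\<^sub>M UNIV (\<lambda>_. R)). \<forall>i\<in>I. point_count (B i) k x = \<kappa> i} =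
    fact k * (\<Prod>i\<in>I. measure R (B i) ^ \<kappa> i / fact (\<kappa> i))"
  using assms(5)
proof (induction k arbitrary: \<kappa>)
  define S where "S = Pi\<^sub>M (UNIV :: nat set) (\<lambda>_. R)"
  interpret R: prob_space R by (fact R)
  interpret S: prob_space S unfolding S_def by (intro prob_space_PiM R)
  {
    case 0
    then have "\<kappa> i = 0" if "i \<in> I" for i using that I by simp
    then show ?case
      using S.prob_space by (simp add: point_count_def S_def)
  next
    case (Suc k)
    define A where "A = (\<lambda>\<kappa>'. {x \<in> space S. \<forall>i\<in>I. point_count (B i) k x = \<kappa>' i})"
    \<comment> \<open>The counts that remain when the last point is taken out of cell
      \<open>i\<close>; restricting to \<open>I'\<close> keeps the natural subtraction away from
      0.\<close>
    define \<kappa>' where "\<kappa>' = (\<lambda>i. \<kappa>(i := \<kappa> i - 1))"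
    define I' where "I' = {i \<in> I. 0 < \<kappa> i}"
    have [measurable]: "point_count (B i) k \<in> measurable S (count_space UNIV)" if "i \<in> I" for i
      unfolding S_def using that by measurable
    have [measurable]: "A \<theta> \<in> sets S" for \<theta>
      unfolding A_def using I(1) by measurable
    have comp [measurable]: "(\<lambda>x. x k) \<in> measurable S R"
      unfolding S_def by measurable
    have count_Suc: "point_count C (Suc k) x = point_count C k x + indicator C (x k)" for C x
      by (simp add: point_count_def)
    have eq: "{x \<in> space S. \<forall>i\<in>I. point_count (B i) (Suc k) x = \<kappa> i} =
        (\<Union>i\<in>I'. A (\<kappa>' i) \<inter> {x \<in> space S. x k \<in> B i})" (is "?L = ?R")
    proof (intro equalityI subsetI)
      fix x assume x: "x \<in> ?L"
      \<comment> \<open>The first \<open>k\<close> points contribute at most \<open>k\<close> to the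
        total \<open>Suc k\<close>, so the last one lies in some cell.\<close>
      have "Suc k = (\<Sum>i\<in>I. point_count (B i) k x) + (\<Sum>i\<in>I. indicator (B i) (x k))"
        using x Suc.prems by (simp add: sum.distrib[symmetric] count_Suc)
      with sum_point_count_le[OF I, of k x] have "(\<Sum>i\<in>I. indicator (B i) (x k) :: nat) \<noteq> 0"
        by linarith
      then obtain i where i: "i \<in> I" "x k \<in> B i"
        by (metis (mono_tags, lifting) indicator_simps(2) sum.neutral)
      have other: "x k \<notin> B j" if "j \<in> I" "j \<noteq> i" for j
        using i that I(2) by (auto simp: disjoint_family_on_def)
      have "\<kappa> i = point_count (B i) k x + 1"
        using x i by (auto simp: count_Suc)
      moreover have "\<kappa> j = point_count (B j) k x" if "j \<in> I" "j \<noteq> i" for j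
        using x that other[OF that] by (auto simp: count_Suc)
      ultimately show "x \<in> ?R"
        using i x by (auto simp: A_def I'_def \<kappa>'_def)
    next
      fix x assume "x \<in> ?R"
      then obtain i where i: "i \<in> I" "0 < \<kappa> i" "x k \<in> B i" "x \<in> A (\<kappa>' i)" "x \<in> space S"
        by (auto simp: I'_def)
      have "x k \<notin> B j" if "j \<in> I" "j \<noteq> i" for j
        using i that I(2) by (auto simp: disjoint_family_on_def)
      then show "x \<in> ?L"
        using i by (auto simp: A_def count_Suc \<kappa>'_def indicator_def)
    qed
    \<comment> \<open>The event \<open>A \<theta>\<close> looks only at coordinates below
      \<open>k\<close> and is therefore independent of coordinate \<open>k\<close>.\<close>
    have ind: "S.prob (A \<theta> \<inter> {x \<in> space S. x k \<in> B i}) = S.prob (A \<theta>) * measure R (B i)"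
      if i: "i \<in> I" for \<theta> i
    proof -
      have iv: "S.indep_vars (\<lambda>_. R) (\<lambda>j x. x j) UNIV"
        unfolding S_def by (rule indep_vars_PiM_component) (simp_all add: R)
      have "S.indep_var (Pi\<^sub>M {..<k} (\<lambda>_. R)) (\<lambda>x. restrict (\<lambda>j. x j) {..<k})
          (Pi\<^sub>M {k} (\<lambda>_. R)) (\<lambda>x. restrict (\<lambda>j. x j) {k})"
        by (rule S.indep_var_restrict[OF iv]) auto
      note S.indep_varD[OF this,
          of "{y \<in> space (Pi\<^sub>M {..<k} (\<lambda>_. R)). \<forall>i\<in>I. point_count (B i) k y = \<theta> i}"
             "{y \<in> space (Pi\<^sub>M {k} (\<lambda>_. R)). y k \<in> B i}"]
      moreover have "{y \<in> space (Pi\<^sub>M {..<k} (\<lambda>_. R)). \<forall>i\<in>I. point_count (B i) k y = \<theta> i} \<in> sets (Pi\<^sub>M {..<k} (\<lambda>_. R))"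
      proof -
        have [measurable]: "(\<lambda>y. y j) \<in> measurable (Pi\<^sub>M {..<k} (\<lambda>_. R)) R" if "j < k" for j
          using that by (intro measurable_component_singleton) simp
        have [measurable]: "point_count (B i) k \<in> measurable (Pi\<^sub>M {..<k} (\<lambda>_. R)) (count_space UNIV)" if "i \<in> I" for i
          unfolding point_count_def indicator_def using that by measurable
        show ?thesis using I(1) by measurable
      qed
      moreover have "{y \<in> space (Pi\<^sub>M {k} (\<lambda>_. R)). y k \<in> B i} \<in> sets (Pi\<^sub>M {k} (\<lambda>_. R))"
        using i by measurable
      moreover have "(\<lambda>x. (restrict (\<lambda>j. x j) {..<k}, restrict (\<lambda>j. x j) {k})) -`
          ({y \<in> space (Pi\<^sub>M {..<k} (\<lambda>_. R)). \<forall>i\<in>I. point_count (B i) k y = \<theta> i} \<times>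
           {y \<in> space (Pi\<^sub>M {k} (\<lambda>_. R)). y k \<in> B i}) \<inter> space S =
          A \<theta> \<inter> {x \<in> space S. x k \<in> B i}"
        by (auto simp: A_def S_def space_PiM PiE_iff point_count_def)
      moreover have "(\<lambda>x. restrict (\<lambda>j. x j) {..<k}) -`
          {y \<in> space (Pi\<^sub>M {..<k} (\<lambda>_. R)). \<forall>i\<in>I. point_count (B i) k y = \<theta> i} \<inter> space S = A \<theta>"
        by (auto simp: A_def S_def space_PiM PiE_iff point_count_def)
      moreover have "(\<lambda>x. restrict (\<lambda>j. x j) {k}) -` {y \<in> space (Pi\<^sub>M {k} (\<lambda>_. R)). y k \<in> B i} \<inter> space S
          = (\<lambda>x. x k) -` B i \<inter> space S"
        by (auto simp: S_def space_PiM PiE_iff)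
      moreover have "S.prob ((\<lambda>x. x k) -` B i \<inter> space S) = measure R (B i)"
      proof -
        have "measure (distr S R (\<lambda>x. x k)) (B i) = S.prob ((\<lambda>x. x k) -` B i \<inter> space S)"
          using i by (intro measure_distr) auto
        moreover have "distr S R (\<lambda>x. x k) = R"
          unfolding S_def by (rule distr_PiM_component) (simp_all add: R)
        ultimately show ?thesis by simp
      qed
      ultimately show ?thesis by simp
    qed
    \<comment> \<open>The extra factor restores the power of the cell probability, and lowering a
      count c by one multiplies 1/c! by c. Summing the counts over the cells then gives k + 1 and
      turns k! into (k + 1)!.\<close>
    have step: "S.prob (A (\<kappa>' i)) * measure R (B i) =
        fact k * real (\<kappa> i) * (\<Prod>i\<in>I. measure R (B i) ^ \<kappa> i / fact (\<kappa> i))" if i: "i \<in> I'" for i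
    proof -
      from i obtain l where l: "\<kappa> i = Suc l" and iI: "i \<in> I"
        by (auto simp: I'_def gr0_conv_Suc)
      have "(\<Sum>j\<in>I. \<kappa>' i j) = k"
        using Suc.prems sum.remove[OF I(1) iI, of \<kappa>] sum.remove[OF I(1) iI, of "\<kappa>' i"] l
        by (simp add: \<kappa>'_def)
      from Suc.IH[OF this] have "S.prob (A (\<kappa>' i)) =
          fact k * (\<Prod>j\<in>I. measure R (B j) ^ \<kappa>' i j / fact (\<kappa>' i j))"
        by (simp add: S_def A_def)
      also have "(\<Prod>j\<in>I. measure R (B j) ^ \<kappa>' i j / fact (\<kappa>' i j)) =
          measure R (B i) ^ l / fact l * (\<Prod>j\<in>I - {i}. measure R (B j) ^ \<kappa> j / fact (\<kappa> j))"
        using I(1) iI l by (subst prod.remove[of _ i]) (auto simp: \<kappa>'_def intro!: prod.cong)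
      finally have "S.prob (A (\<kappa>' i)) * measure R (B i) = fact k *
          (measure R (B i) * (measure R (B i) ^ l / fact l)) * (\<Prod>j\<in>I - {i}. measure R (B j) ^ \<kappa> j / fact (\<kappa> j))"
        by (simp only: mult_ac)
      also have "measure R (B i) * (measure R (B i) ^ l / fact l) =
          real (\<kappa> i) * (measure R (B i) ^ \<kappa> i / fact (\<kappa> i))"
        by (simp add: l del: of_nat_Suc)
      finally show ?thesis
        by (subst prod.remove[OF I(1) iI]) (simp only: mult_ac)
    qed
    have "S.prob {x \<in> space S. \<forall>i\<in>I. point_count (B i) (Suc k) x = \<kappa> i} =
        (\<Sum>i\<in>I'. S.prob (A (\<kappa>' i) \<inter> {x \<in> space S. x k \<in> B i}))"
      unfolding eq
    proof (intro S.finite_measure_finite_Union)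
      show "finite I'" using I(1) by (simp add: I'_def)
      show "(\<lambda>i. A (\<kappa>' i) \<inter> {x \<in> space S. x k \<in> B i}) ` I' \<subseteq> S.events"
        by (auto simp: I'_def)
      show "disjoint_family_on (\<lambda>i. A (\<kappa>' i) \<inter> {x \<in> space S. x k \<in> B i}) I'"
        using I(2) by (auto simp: disjoint_family_on_def I'_def)
    qed
    also have "\<dots> = (\<Sum>i\<in>I'. fact k * real (\<kappa> i) * (\<Prod>i\<in>I. measure R (B i) ^ \<kappa> i / fact (\<kappa> i)))"
      using ind step by (intro sum.cong) (auto simp: I'_def)
    also have "\<dots> = fact k * (\<Sum>i\<in>I'. real (\<kappa> i)) * (\<Prod>i\<in>I. measure R (B i) ^ \<kappa> i / fact (\<kappa> i))"
      by (simp add: sum_distrib_left sum_distrib_right)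
    also have "(\<Sum>i\<in>I'. real (\<kappa> i)) = real (\<Sum>i\<in>I. \<kappa> i)"
      unfolding I'_def of_nat_sum by (intro sum.mono_neutral_left) (auto simp: I(1))
    finally show ?case
      using Suc.prems by (simp add: S_def algebra_simps)
  }
qed

text \<open>Given by the formula so that a = 0 is allowed and means the point mass at 0; this occurs
  for increments over stretches without mass.\<close>

definition poisson_weight :: "real \<Rightarrow> nat \<Rightarrow> real" where
  "poisson_weight a k = a ^ k / fact k * exp (- a)"

lemma poisson_weight_sums: "poisson_weight a sums 1"
proof -
  have "(\<lambda>k. a ^ k / fact k) sums exp a"
    using exp_converges[of a] by (simp add: divide_inverse mult.commute)
  from sums_mult2[OF this, of "exp (- a)"] show ?thesis
    by (simp add: poisson_weight_def[abs_def] exp_minus)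
qed

text \<open>
  A Poisson number of independent points: a Poisson point process with intensity \<open>m R\<close>. The sequence
  of points is infinite and only its first \<open>fst \<omega>\<close> entries count.
\<close>
definition poisson_sample :: "real \<Rightarrow> 'a measure \<Rightarrow> (nat \<times> (nat \<Rightarrow> 'a)) measure" where
  "poisson_sample m R = measure_pmf (poisson_pmf m) \<Otimes>\<^sub>M Pi\<^sub>M UNIV (\<lambda>_. R)"

definition sample_count :: "'a set \<Rightarrow> nat \<times> (nat \<Rightarrow> 'a) \<Rightarrow> nat" where
  "sample_count B \<omega> = point_count B (fst \<omega>) (snd \<omega>)"

lemma prob_space_poisson_sample:
  assumes "prob_space R"
  shows "prob_space (poisson_sample m R)"
proof -
  interpret S: prob_space "Pi\<^sub>M (UNIV :: nat set) (\<lambda>_. R)" by (intro prob_space_PiM assms)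
  interpret pair_prob_space "measure_pmf (poisson_pmf m)" "Pi\<^sub>M (UNIV :: nat set) (\<lambda>_. R)" ..
  show ?thesis unfolding poisson_sample_def by (fact prob_space_axioms)
qed

lemma sample_count_measurable [measurable]:
  assumes [measurable]: "B \<in> sets R"
  shows "sample_count B \<in> measurable (poisson_sample m R) (count_space UNIV)"
proof -
  have "sample_count B \<in> measurable (count_space UNIV \<Otimes>\<^sub>M Pi\<^sub>M UNIV (\<lambda>_. R)) (count_space UNIV)"
    by (rule measurable_pair_measure_countable1) (auto simp: sample_count_def)
  then show ?thesis
    unfolding poisson_sample_def
    by (subst measurable_cong_sets[OF sets_pair_measure_cong[OF sets_measure_pmf_count_space refl] refl])
qed

text \<open>On a partition the counts add up to the number of points, so the event fixes that
  number. The factorial of the multinomial formula cancels the one in the Poisson probability, and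
  \<open>m ^ k * exp (- m)\<close> factors over the cells because their probabilities add up to
  1.\<close>

lemma prob_sample_counts_partition:
  assumes R: "prob_space R" and m: "0 < m" and I: "finite I" "disjoint_family_on B I"
    and B [measurable]: "\<And>i. i \<in> I \<Longrightarrow> B i \<in> sets R" and part: "(\<Union>i\<in>I. B i) = space R"
  shows "measure (poisson_sample m R) {\<omega> \<in> space (poisson_sample m R). \<forall>i\<in>I. sample_count (B i) \<omega> = \<kappa> i} =
    (\<Prod>i\<in>I. poisson_weight (m * measure R (B i)) (\<kappa> i))"
proof -
  interpret R: prob_space R by (fact R)
  define S where "S = Pi\<^sub>M (UNIV :: nat set) (\<lambda>_. R)"
  interpret S: prob_space S unfolding S_def by (intro prob_space_PiM R)
  define k where "k = (\<Sum>i\<in>I. \<kappa> i)"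
  define A where "A = {x \<in> space S. \<forall>i\<in>I. point_count (B i) k x = \<kappa> i}"
  have [measurable]: "A \<in> sets S"
    unfolding A_def S_def using I(1) by measurable
  have total: "(\<Sum>i\<in>I. point_count (B i) l x) = l" if "x \<in> space S" for l x
  proof -
    have "(\<Sum>i\<in>I. indicator (B i) (x j) :: nat) = 1" for j
    proof -
      have "x j \<in> space R" using that by (auto simp: S_def space_PiM)
      then show ?thesis
        unfolding indicator_UN_disjoint[OF I, symmetric] part by simp
    qed
    then show ?thesis
      unfolding point_count_def by (subst sum.swap) simp
  qed
  have "{\<omega> \<in> space (poisson_sample m R). \<forall>i\<in>I. sample_count (B i) \<omega> = \<kappa> i} = {k} \<times> A" (is "?L = _")
  proof -
    have "fst \<omega> = k" if "\<omega> \<in> ?L" for \<omega>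
    proof -
      have "snd \<omega> \<in> space S" using that by (auto simp: poisson_sample_def space_pair_measure S_def)
      from total[OF this, of "fst \<omega>"] that show ?thesis
        by (simp add: sample_count_def k_def)
    qed
    then show ?thesis
      by (auto simp: poisson_sample_def space_pair_measure sample_count_def A_def S_def)
  qed
  moreover have "emeasure (poisson_sample m R) ({k} \<times> A) = emeasure (measure_pmf (poisson_pmf m)) {k} * emeasure S A"
    unfolding poisson_sample_def S_def[symmetric] by (intro S.emeasure_pair_measure_Times) auto
  ultimately have "measure (poisson_sample m R)
      {\<omega> \<in> space (poisson_sample m R). \<forall>i\<in>I. sample_count (B i) \<omega> = \<kappa> i} = pmf (poisson_pmf m) k * S.prob A"
    by (simp only: measure_def enn2real_mult pmf.rep_eq)
  also have "S.prob A = fact k * (\<Prod>i\<in>I. measure R (B i) ^ \<kappa> i / fact (\<kappa> i))"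
    unfolding A_def S_def by (rule prob_point_counts[OF R I B]) (auto simp: k_def)
  also have "pmf (poisson_pmf m) k * \<dots> = (\<Prod>i\<in>I. m ^ \<kappa> i) * exp (- m) * (\<Prod>i\<in>I. measure R (B i) ^ \<kappa> i / fact (\<kappa> i))"
    using m by (simp add: k_def power_sum)
  also have "exp (- m) = (\<Prod>i\<in>I. exp (- (m * measure R (B i))))"
  proof -
    have "(\<Sum>i\<in>I. measure R (B i)) = measure R (\<Union>i\<in>I. B i)"
      using I by (intro R.finite_measure_finite_Union[symmetric]) auto
    then have "(\<Sum>i\<in>I. - (m * measure R (B i))) = - m"
      by (simp add: part R.prob_space sum_negf flip: sum_distrib_left)
    then show ?thesis using I(1) by (simp flip: exp_sum)
  qed
  finally show ?thesis
    by (simp add: prod.distrib[symmetric] poisson_weight_def power_mult_distrib mult_ac)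
qed

lemma prob_sample_counts:
  fixes B :: "nat \<Rightarrow> 'a set"
  assumes R: "prob_space R" and m: "0 < m" and disj: "disjoint_family_on B {..<n}"
    and B [measurable]: "\<And>i. i < n \<Longrightarrow> B i \<in> sets R"
  shows "measure (poisson_sample m R) {\<omega> \<in> space (poisson_sample m R). \<forall>i<n. sample_count (B i) \<omega> = \<kappa> i} =
    (\<Prod>i<n. poisson_weight (m * measure R (B i)) (\<kappa> i))"
proof -
  interpret \<Omega>: prob_space "poisson_sample m R" by (rule prob_space_poisson_sample[OF R])
  \<comment> \<open>The cells are completed to a partition, and the count of the extra cell is summed out.\<close>
  define C where "C = B(n := space R - (\<Union>i<n. B i))"
  define E where "E = (\<lambda>l. {\<omega> \<in> space (poisson_sample m R). \<forall>i\<in>{..<Suc n}. sample_count (C i) \<omega> = (\<kappa>(n := l)) i})"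
  have C [measurable]: "C i \<in> sets R" if "i \<in> {..<Suc n}" for i
    using that by (auto simp: C_def less_Suc_eq intro!: sets.finite_UN)
  have disjC: "disjoint_family_on C {..<Suc n}"
    using disj unfolding disjoint_family_on_def by (fastforce simp: C_def less_Suc_eq)
  have part: "(\<Union>i\<in>{..<Suc n}. C i) = space R"
  proof -
    have "(\<Union>i\<in>{..<Suc n}. C i) = C n \<union> (\<Union>i<n. B i)"
      by (auto simp: C_def lessThan_Suc)
    also have "\<dots> = space R"
      using sets.sets_into_space[OF B] by (auto simp: C_def)
    finally show ?thesis .
  qed
  have P: "\<Omega>.prob (E l) = (\<Prod>i<n. poisson_weight (m * measure R (B i)) (\<kappa> i)) * poisson_weight (m * measure R (C n)) l" for l
    unfolding E_def
    by (subst prob_sample_counts_partition[OF R m _ disjC C part]) (auto simp: C_def)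
  have "(\<lambda>l. \<Omega>.prob (E l)) sums \<Omega>.prob (\<Union>l. E l)"
  proof (rule \<Omega>.finite_measure_UNION)
    show "range E \<subseteq> \<Omega>.events" unfolding E_def by auto
    show "disjoint_family E" by (auto simp: disjoint_family_on_def E_def lessThan_Suc)
  qed
  moreover have "(\<lambda>l. \<Omega>.prob (E l)) sums (\<Prod>i<n. poisson_weight (m * measure R (B i)) (\<kappa> i))"
    unfolding P using sums_mult[OF poisson_weight_sums] by simp
  moreover have "(\<Union>l. E l) = {\<omega> \<in> space (poisson_sample m R). \<forall>i<n. sample_count (B i) \<omega> = \<kappa> i}"
    by (auto simp: E_def C_def less_Suc_eq)
  ultimately show ?thesis
    by (metis sums_unique2)
qed
section \<open>Counting processes with Poisson increments\<close>

text \<open>Finite-dimensional laws are recorded by natural-valued increments, the first being the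
  value at \<open>q 0\<close>. The function \<open>w\<close> does not mention \<open>P\<close>, so
  processes on different spaces can share it; the almost sure clause leaves room for infinite counts
  on a null set.\<close>

definition increment_law ::
    "'a measure \<Rightarrow> ('a \<Rightarrow> real \<Rightarrow> ennreal) \<Rightarrow> nat \<Rightarrow> (nat \<Rightarrow> real) \<Rightarrow> ((nat \<Rightarrow> nat) \<Rightarrow> real) \<Rightarrow> bool" where
  "increment_law P c n q w \<longleftrightarrow>
     (\<exists>\<Delta> :: nat \<Rightarrow> 'a \<Rightarrow> nat. (\<forall>i<n. \<Delta> i \<in> measurable P (count_space UNIV)) \<and>
       (AE \<omega> in P. \<forall>i<n. c \<omega> (q i) = of_nat (\<Sum>j\<le>i. \<Delta> j \<omega>)) \<and>
       (\<forall>\<kappa>. measure P {\<omega> \<in> space P. \<forall>i<n. \<Delta> i \<omega> = \<kappa> i} = w \<kappa>))"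

text \<open>Increment vectors take countably many values, so the probability is the sum of
  \<open>w\<close> over those compatible with the sets \<open>A i\<close>. The right-hand side
  depends on neither \<open>P\<close> nor \<open>c\<close>.\<close>

lemma increment_law_emeasure:
  assumes P: "prob_space P" and inc: "increment_law P c n q w"
    and [measurable]: "\<And>i. i < n \<Longrightarrow> (\<lambda>\<omega>. c \<omega> (q i)) \<in> borel_measurable P"
      "\<And>i. i < n \<Longrightarrow> A i \<in> sets borel"
  shows "emeasure P {\<omega> \<in> space P. \<forall>i<n. c \<omega> (q i) \<in> A i} =
    (\<integral>\<^sup>+\<kappa>. ennreal (w \<kappa>) * indicator {\<kappa>. \<forall>i<n. of_nat (\<Sum>j\<le>i. \<kappa> j) \<in> A i} \<kappa>
      \<partial>count_space (Pi\<^sub>E {..<n} (\<lambda>_. UNIV)))"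
proof -
  interpret prob_space P by (fact P)
  define X where "X = Pi\<^sub>E {..<n} (\<lambda>_. UNIV :: nat set)"
  have X: "countable X" unfolding X_def by (intro countable_PiE) auto
  obtain \<Delta> :: "nat \<Rightarrow> 'a \<Rightarrow> nat" where \<Delta> [measurable]: "\<And>i. i < n \<Longrightarrow> \<Delta> i \<in> measurable P (count_space UNIV)"
    and c: "AE \<omega> in P. \<forall>i<n. c \<omega> (q i) = of_nat (\<Sum>j\<le>i. \<Delta> j \<omega>)"
    and w: "\<And>\<kappa>. prob {\<omega> \<in> space P. \<forall>i<n. \<Delta> i \<omega> = \<kappa> i} = w \<kappa>"
    using inc unfolding increment_law_def by auto
  define V where "V = (\<lambda>\<omega>. \<lambda>i\<in>{..<n}. \<Delta> i \<omega>)"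
  have V_eq: "V -` {\<kappa>} \<inter> space P = {\<omega> \<in> space P. \<forall>i<n. \<Delta> i \<omega> = \<kappa> i}" if "\<kappa> \<in> X" for \<kappa>
    using that by (auto simp: V_def X_def fun_eq_iff PiE_def extensional_def)
  have V [measurable]: "V \<in> measurable P (count_space X)"
  proof (subst measurable_count_space_eq_countable[OF X], intro conjI ballI)
    show "V \<in> space P \<rightarrow> X" by (auto simp: V_def X_def)
    fix \<kappa> assume "\<kappa> \<in> X"
    then show "V -` {\<kappa>} \<inter> space P \<in> events"
      unfolding V_eq[OF \<open>\<kappa> \<in> X\<close>] by measurable
  qed
  define K where "K = {\<kappa> \<in> X. \<forall>i<n. of_nat (\<Sum>j\<le>i. \<kappa> j) \<in> A i}"
  have KX: "K \<subseteq> X" by (auto simp: K_def)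
  have V_K: "V \<omega> \<in> K \<longleftrightarrow> (\<forall>i<n. of_nat (\<Sum>j\<le>i. \<Delta> j \<omega>) \<in> A i)" for \<omega>
    by (auto simp: K_def V_def X_def)
  have "emeasure P {\<omega> \<in> space P. \<forall>i<n. c \<omega> (q i) \<in> A i} = emeasure P (V -` K \<inter> space P)"
  proof (rule emeasure_eq_AE)
    show "AE \<omega> in P. \<omega> \<in> {\<omega> \<in> space P. \<forall>i<n. c \<omega> (q i) \<in> A i} \<longleftrightarrow> \<omega> \<in> V -` K \<inter> space P"
      using c by eventually_elim (auto simp: V_K)
    show "V -` K \<inter> space P \<in> events"
      using KX by (intro measurable_sets[OF V]) auto
  qed measurable
  also have "\<dots> = emeasure (distr P (count_space X) V) K"
    using KX by (subst emeasure_distr) auto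
  also have "\<dots> = (\<integral>\<^sup>+\<kappa>. emeasure (distr P (count_space X) V) {\<kappa>} \<partial>count_space K)"
    using KX X by (intro emeasure_countable_singleton) (auto intro: countable_subset)
  also have "\<dots> = (\<integral>\<^sup>+\<kappa>. ennreal (w \<kappa>) \<partial>count_space K)"
  proof (rule nn_integral_cong)
    fix \<kappa> assume "\<kappa> \<in> space (count_space K)"
    then have "\<kappa> \<in> X" using KX by auto
    then show "emeasure (distr P (count_space X) V) {\<kappa>} = ennreal (w \<kappa>)"
      by (simp add: emeasure_distr V_eq emeasure_eq_measure w)
  qed
  also have "count_space K = restrict_space (count_space X) K"
    using KX by (simp add: restrict_count_space Int_absorb2)
  also have "(\<integral>\<^sup>+\<kappa>. ennreal (w \<kappa>) \<partial>\<dots>) = (\<integral>\<^sup>+\<kappa>. ennreal (w \<kappa>) * indicator K \<kappa> \<partial>count_space X)"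
    by (intro nn_integral_restrict_space) simp
  also have "\<dots> = (\<integral>\<^sup>+\<kappa>. ennreal (w \<kappa>) * indicator {\<kappa>. \<forall>i<n. of_nat (\<Sum>j\<le>i. \<kappa> j) \<in> A i} \<kappa> \<partial>count_space X)"
    by (rule nn_integral_cong) (simp add: K_def indicator_def)
  finally show ?thesis unfolding X_def .
qed

lemma restrict_vimage_prod_emb:
  assumes "J \<subseteq> Q"
  shows "(\<lambda>\<omega>. \<lambda>q\<in>Q. c \<omega> q) -` prod_emb Q (\<lambda>_. borel) J (Pi\<^sub>E J A) \<inter> S = {\<omega> \<in> S. \<forall>q\<in>J. c \<omega> q \<in> A q}"
  using assms by (auto simp: prod_emb_def PiE_iff subset_iff)

text \<open>A law on the product is determined by its finite-dimensional marginals. Once the times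
  are listed in increasing order, \<open>increment_law_emeasure\<close> computes both marginals from
  the same \<open>w\<close>.\<close>

lemma distr_eq_of_increment_laws:
  fixes c1 :: "'a \<Rightarrow> real \<Rightarrow> ennreal" and c2 :: "'b \<Rightarrow> real \<Rightarrow> ennreal"
  assumes P: "prob_space P1" "prob_space P2"
    and meas [measurable]: "\<And>q. q \<in> Q \<Longrightarrow> (\<lambda>\<omega>. c1 \<omega> q) \<in> borel_measurable P1"
      "\<And>q. q \<in> Q \<Longrightarrow> (\<lambda>\<omega>. c2 \<omega> q) \<in> borel_measurable P2"
    and inc: "\<And>n q. (\<And>i. i < n \<Longrightarrow> q i \<in> Q) \<Longrightarrow> (\<And>i j. i < j \<Longrightarrow> j < n \<Longrightarrow> q i < q j) \<Longrightarrow>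
      \<exists>w. increment_law P1 c1 n q w \<and> increment_law P2 c2 n q w"
  shows "distr P1 (Pi\<^sub>M Q (\<lambda>_. borel)) (\<lambda>\<omega>. \<lambda>q\<in>Q. c1 \<omega> q) = distr P2 (Pi\<^sub>M Q (\<lambda>_. borel)) (\<lambda>\<omega>. \<lambda>q\<in>Q. c2 \<omega> q)"
proof (rule measure_eqI_PiM_infinite)
  interpret P1: prob_space P1 by (fact P)
  have M: "(\<lambda>\<omega>. \<lambda>q\<in>Q. c1 \<omega> q) \<in> measurable P1 (Pi\<^sub>M Q (\<lambda>_. borel))"
    "(\<lambda>\<omega>. \<lambda>q\<in>Q. c2 \<omega> q) \<in> measurable P2 (Pi\<^sub>M Q (\<lambda>_. borel))"
    by (auto intro!: measurable_restrict)
  then show "finite_measure (distr P1 (Pi\<^sub>M Q (\<lambda>_. borel)) (\<lambda>\<omega>. \<lambda>q\<in>Q. c1 \<omega> q))"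
    by (intro P1.finite_measure_distr)
  fix A :: "real \<Rightarrow> ennreal set" and J
  assume J: "finite J" "J \<subseteq> Q" and A: "\<And>i. i \<in> J \<Longrightarrow> A i \<in> sets borel"
  define n where "n = card J"
  define q where "q = (\<lambda>i. sorted_list_of_set J ! i)"
  have Jq: "J = q ` {..<n}"
    using J(1) by (metis n_def q_def set_conv_nth set_sorted_list_of_set length_sorted_list_of_set
      lessThan_def setcompr_eq_image)
  have mono: "q i < q j" if "i < j" "j < n" for i j
    unfolding q_def using J(1) that
    by (intro sorted_wrt_nth_less[of "(<)"]) (auto simp: n_def)
  have qQ: "q i \<in> Q" if "i < n" for i using that J Jq by auto
  from inc[of n q, OF qQ mono] obtain w where w: "increment_law P1 c1 n q w" "increment_law P2 c2 n q w"
    by auto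
  have A': "A (q i) \<in> sets borel" if "i < n" for i using A Jq that by auto
  have emb: "prod_emb Q (\<lambda>_. borel) J (Pi\<^sub>E J A) \<in> sets (Pi\<^sub>M Q (\<lambda>_. borel))"
    using J A by (intro sets_PiM_I) auto
  have "emeasure (distr P1 (Pi\<^sub>M Q (\<lambda>_. borel)) (\<lambda>\<omega>. \<lambda>q\<in>Q. c1 \<omega> q)) (prod_emb Q (\<lambda>_. borel) J (Pi\<^sub>E J A)) =
      emeasure P1 {\<omega> \<in> space P1. \<forall>i<n. c1 \<omega> (q i) \<in> A (q i)}"
    unfolding emeasure_distr[OF M(1) emb] restrict_vimage_prod_emb[OF J(2)] by (simp add: Jq lessThan_def)
  also have "\<dots> = emeasure P2 {\<omega> \<in> space P2. \<forall>i<n. c2 \<omega> (q i) \<in> A (q i)}"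
    using increment_law_emeasure[OF P(1) w(1) meas(1) A'] increment_law_emeasure[OF P(2) w(2) meas(2) A'] qQ
    by simp
  also have "\<dots> = emeasure (distr P2 (Pi\<^sub>M Q (\<lambda>_. borel)) (\<lambda>\<omega>. \<lambda>q\<in>Q. c2 \<omega> q)) (prod_emb Q (\<lambda>_. borel) J (Pi\<^sub>E J A))"
    unfolding emeasure_distr[OF M(2) emb] restrict_vimage_prod_emb[OF J(2)] by (simp add: Jq lessThan_def)
  finally show "emeasure (distr P1 (Pi\<^sub>M Q (\<lambda>_. borel)) (\<lambda>\<omega>. \<lambda>q\<in>Q. c1 \<omega> q)) (prod_emb Q (\<lambda>_. borel) J (Pi\<^sub>E J A)) =
    emeasure (distr P2 (Pi\<^sub>M Q (\<lambda>_. borel)) (\<lambda>\<omega>. \<lambda>q\<in>Q. c2 \<omega> q)) (prod_emb Q (\<lambda>_. borel) J (Pi\<^sub>E J A))" .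
qed simp_all

section \<open>Increments of the sampled and of the given counting process\<close>

definition cell :: "(nat \<Rightarrow> real) \<Rightarrow> nat \<Rightarrow> real set" where
  "cell b i = (if i = 0 then {..b 0} else {b (i - 1)<..b i})"

definition increment :: "(nat \<Rightarrow> real) \<Rightarrow> nat \<Rightarrow> real" where
  "increment b i = b i - (if i = 0 then 0 else b (i - 1))"

text \<open>The bounds increase only weakly: levels stay equal on stretches without mass, and the
  cell between equal bounds is empty.\<close>

lemma disjoint_cells:
  assumes "\<And>i j. i \<le> j \<Longrightarrow> j < n \<Longrightarrow> b i \<le> b j"
  shows "disjoint_family_on (cell b) {..<n}"
proof -
  have "cell b i \<inter> cell b j = {}" if "i < j" "j < n" for i j
  proof -
    have "b i \<le> b (j - 1)" using that by (intro assms) auto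
    then show ?thesis using that by (auto simp: cell_def)
  qed
  then show ?thesis
    by (auto simp: disjoint_family_on_def) (metis IntI empty_iff linorder_neqE_nat)
qed

lemma cell_sets [measurable]: "cell b i \<in> sets borel"
  by (simp add: cell_def)

abbreviation uniform_upto :: "real \<Rightarrow> real measure" where
  "uniform_upto m \<equiv> uniform_measure lborel {0..m}"

lemma prob_space_uniform_upto: "0 < m \<Longrightarrow> prob_space (uniform_upto m)"
  by (rule prob_space_uniform_measure) auto

text \<open>The factor \<open>m\<close> undoes the normalisation of the uniform law, so that
  probabilities of cells become lengths.\<close>

lemma measure_uniform_cell:
  assumes "0 < m" "\<And>i j. i \<le> j \<Longrightarrow> j < n \<Longrightarrow> b i \<le> b j" "\<And>i. i < n \<Longrightarrow> 0 \<le> b i \<and> b i \<le> m" "i < n"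
  shows "m * measure (uniform_upto m) (cell b i) = increment b i"
proof -
  have "measure (uniform_upto m) (cell b i) = measure lborel ({0..m} \<inter> cell b i) / m"
    using assms(1) by (subst measure_uniform_measure) auto
  also have "measure lborel ({0..m} \<inter> cell b i) = increment b i"
  proof (cases i)
    case 0
    then have "{0..m} \<inter> cell b i = {0..b 0}" using assms(3)[OF assms(4)] by (auto simp: cell_def)
    then show ?thesis using 0 assms(3)[OF assms(4)] by (simp add: increment_def)
  next
    case (Suc k)
    have "{0..m} \<inter> cell b i = {b k<..b i}"
      using assms(3)[of k] assms(3)[of i] assms(4) Suc by (auto simp: cell_def)
    then show ?thesis using Suc assms(2)[of k i] assms(4) by (simp add: increment_def)
  qed
  finally show ?thesis using assms(1) by simp
qed

lemma point_count_Un: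
  "A \<inter> B = {} \<Longrightarrow> point_count (A \<union> B) k x = point_count A k x + point_count B k x"
  unfolding point_count_def sum.distrib[symmetric] by (rule sum.cong) (auto simp: indicator_def)

lemma sample_count_atMost:
  assumes "\<And>i j. i \<le> j \<Longrightarrow> j < n \<Longrightarrow> b i \<le> b j" "i < n"
  shows "sample_count {..b i} \<omega> = (\<Sum>j\<le>i. sample_count (cell b j) \<omega>)"
  using assms(2)
proof (induction i)
  case (Suc i)
  have "{..b (Suc i)} = {..b i} \<union> cell b (Suc i)" "{..b i} \<inter> cell b (Suc i) = {}"
    using assms(1)[of i "Suc i"] Suc.prems by (auto simp: cell_def)
  then show ?case
    using Suc by (simp add: sample_count_def point_count_Un)
qed (simp add: cell_def)

text \<open>The time change: at time t the sample is read up to the level \<open>F t\<close>, so the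
  mean of an increment is a difference of levels. It will be applied with F t = \<mu>[0,t].\<close>

lemma increment_law_sample:
  assumes m: "0 < m" and mono: "\<And>i j. i \<le> j \<Longrightarrow> j < n \<Longrightarrow> F (q i) \<le> F (q j)"
    and range: "\<And>i. i < n \<Longrightarrow> 0 \<le> F (q i) \<and> F (q i) \<le> m"
  shows "increment_law (poisson_sample m (uniform_upto m)) (\<lambda>\<omega> t. of_nat (sample_count {..F t} \<omega>)) n q
    (\<lambda>\<kappa>. \<Prod>i<n. poisson_weight (increment (\<lambda>i. F (q i)) i) (\<kappa> i))"
  unfolding increment_law_def
proof (intro exI[where x="\<lambda>i. sample_count (cell (\<lambda>i. F (q i)) i)"] conjI allI impI)
  let ?b = "\<lambda>i. F (q i)"
  show "sample_count (cell ?b i) \<in> measurable (poisson_sample m (uniform_upto m)) (count_space UNIV)" for i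
    by (intro sample_count_measurable) simp
  show "AE \<omega> in poisson_sample m (uniform_upto m). \<forall>i<n.
      of_nat (sample_count {..F (q i)} \<omega>) = of_nat (\<Sum>j\<le>i. sample_count (cell ?b j) \<omega>)"
    using sample_count_atMost[where b="?b", OF mono] by simp
  show "measure (poisson_sample m (uniform_upto m))
      {\<omega> \<in> space (poisson_sample m (uniform_upto m)). \<forall>i<n. sample_count (cell ?b i) \<omega> = \<kappa> i} =
      (\<Prod>i<n. poisson_weight (increment ?b i) (\<kappa> i))" for \<kappa>
    by (subst prob_sample_counts[OF prob_space_uniform_upto[OF m] m disjoint_cells[where b="?b", OF mono]])
       (auto intro!: prod.cong simp: measure_uniform_cell[where b="?b", OF m mono range])
qed

text \<open>The mass of a set is the number of indices mapped into it.\<close>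

lemma emeasure_point_measure_finite:
  assumes "\<nu> \<in> space point_measures" "B \<in> sets half_line" "emeasure \<nu> B < \<infinity>"
  shows "\<exists>k. emeasure \<nu> B = of_nat k"
proof -
  from assms(1) obtain J :: "nat set" and x where x: "x \<in> J \<rightarrow> {0..}" "\<nu> = distr (count_space J) half_line x"
    by (auto simp: space_point_measures point_measure_on_half_line_def)
  have "x \<in> measurable (count_space J) half_line"
    using x(1) by (auto simp: space_restrict_space)
  then have "emeasure \<nu> B = emeasure (count_space J) (x -` B \<inter> J)"
    using assms(2) x(2) by (simp add: emeasure_distr)
  with assms(3) show ?thesis
    by (cases "finite (x -` B \<inter> J)") (auto simp: emeasure_count_space)
qed

lemma cell_in_half_line: "{0..} \<inter> cell b i \<in> sets half_line"
  by (auto simp: sets_restrict_space)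

text \<open>The half-line cuts the first cell, which has no left end, down to
  \<open>{0..q 0}\<close>; points at 0 are thus counted.\<close>

lemma emeasure_atLeastAtMost_cells:
  assumes sets: "sets \<nu> = sets half_line" and mono: "\<And>i j. i \<le> j \<Longrightarrow> j < n \<Longrightarrow> q i \<le> q j"
    and nonneg: "\<And>i. i < n \<Longrightarrow> 0 \<le> q i" and "i < n"
  shows "emeasure \<nu> {0..q i} = (\<Sum>j\<le>i. emeasure \<nu> ({0..} \<inter> cell q j))"
  using assms(4)
proof (induction i)
  case 0
  have "{0..q 0} = {0..} \<inter> cell q 0" by (auto simp: cell_def)
  then show ?case by simp
next
  case (Suc i)
  have "{0..q (Suc i)} = {0..q i} \<union> ({0..} \<inter> cell q (Suc i))" "{0..q i} \<inter> ({0..} \<inter> cell q (Suc i)) = {}"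
    using mono[of i "Suc i"] nonneg[of i] Suc.prems by (auto simp: cell_def)
  then show ?case
    using Suc by (simp add: plus_emeasure[symmetric] sets cell_in_half_line atLeastAtMost_in_half_line)
qed

lemma sets_poisson_intensity:
  assumes "poisson_point_process P \<xi> \<mu>"
  shows "sets \<mu> = sets half_line"
  using assms sets.sigma_sets_eq[of half_line] sets.space_closed[of half_line]
  by (simp add: poisson_point_process_def intensity_measure_def space_restrict_space)

text \<open>The counts of disjoint cells are independent Poisson variables, and the masses of the
  cells are differences of \<mu>[0,q i]. The weights are those of
  \<open>increment_law_sample\<close> with F t = \<mu>[0,t], and this agreement identifies the two
  laws.\<close>

lemma increment_law_poisson_point_process:
  assumes rep: "reproduction_point_process P \<xi>" and poi: "poisson_point_process P \<xi> \<mu>"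
    and fin: "\<And>i. i < n \<Longrightarrow> emeasure \<mu> {0..q i} < \<infinity>"
    and mono: "\<And>i j. i \<le> j \<Longrightarrow> j < n \<Longrightarrow> q i \<le> q j"
    and nonneg: "\<And>i. i < n \<Longrightarrow> 0 \<le> q i"
  shows "increment_law P (\<lambda>\<omega> t. emeasure (\<xi> \<omega>) {0..t}) n q
    (\<lambda>\<kappa>. \<Prod>i<n. poisson_weight (increment (\<lambda>i. measure \<mu> {0..q i}) i) (\<kappa> i))"
proof -
  have pp: "point_process P \<xi>"
    using poi by (auto simp: poisson_point_process_def)
  interpret prob_space P using pp by (simp add: point_process_def)
  have xi [measurable]: "\<xi> \<in> measurable P point_measures"
    using pp by (simp add: point_process_def)
  have sets_xi: "sets (\<xi> \<omega>) = sets half_line" if "\<omega> \<in> space P" for \<omega>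
    using sets_point_measure measurable_space[OF xi that] .
  have sets_\<mu>: "sets \<mu> = sets half_line"
    by (rule sets_poisson_intensity[OF poi])
  define B where "B = (\<lambda>i. {0..} \<inter> cell q i)"
  have B: "B i \<in> sets half_line" for i unfolding B_def by (rule cell_in_half_line)
  have meas [measurable]: "(\<lambda>\<omega>. emeasure (\<xi> \<omega>) (B i)) \<in> borel_measurable P" for i
    using measurable_compose[OF xi measurable_emeasure_point_measures[OF B]] .
  have BJ: "B i \<subseteq> {0..q i}" for i by (auto simp: B_def cell_def)
  have finB: "emeasure \<mu> (B i) < \<infinity>" if "i < n" for i
    using emeasure_mono[OF BJ, of i \<mu>] fin[OF that] sets_\<mu> atLeastAtMost_in_half_line
    by (auto intro: le_less_trans)
  have disj: "disjoint_family_on B {..<n}"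
    using disjoint_cells[of n q, OF mono] by (auto simp: disjoint_family_on_def B_def)
  have \<mu>B: "measure \<mu> (B i) = increment (\<lambda>i. measure \<mu> {0..q i}) i" if "i < n" for i
  proof (cases i)
    case 0
    have "B 0 = {0..q 0}" by (auto simp: B_def cell_def)
    with 0 show ?thesis by (simp add: increment_def)
  next
    case (Suc k)
    have "B i = {0..q i} - {0..q k}"
      using nonneg[of k] Suc that by (auto simp: B_def cell_def)
    moreover have "measure \<mu> ({0..q i} - {0..q k}) = measure \<mu> {0..q i} - measure \<mu> {0..q k}"
      using fin[OF that] mono[of k i] that Suc atLeastAtMost_in_half_line
      by (intro measure_Diff) (auto simp: sets_\<mu>)
    ultimately show ?thesis using Suc by (simp add: increment_def)
  qed
  \<comment> \<open>Counts are extended-valued: this recovers the natural number where they are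
    finite and gives 0 elsewhere.\<close>
  define \<Delta> where "\<Delta> = (\<lambda>i \<omega>. nat \<lfloor>enn2real (emeasure (\<xi> \<omega>) (B i))\<rfloor>)"
  have "AE \<omega> in P. \<forall>i\<in>{..<n}. emeasure (\<xi> \<omega>) {0..q i} < \<infinity>"
    using rep nonneg by (intro AE_finite_allI) (auto simp: reproduction_point_process_def)
  then have \<Delta>: "AE \<omega> in P. \<forall>i<n. emeasure (\<xi> \<omega>) (B i) = of_nat (\<Delta> i \<omega>)"
  proof (rule AE_mp, intro AE_I2 impI allI)
    fix \<omega> i assume \<omega>: "\<omega> \<in> space P" and f: "\<forall>i\<in>{..<n}. emeasure (\<xi> \<omega>) {0..q i} < \<infinity>" and i: "i < n"
    have "emeasure (\<xi> \<omega>) (B i) \<le> emeasure (\<xi> \<omega>) {0..q i}"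
      by (rule emeasure_mono[OF BJ]) (simp add: sets_xi[OF \<omega>] atLeastAtMost_in_half_line)
    with f i have "emeasure (\<xi> \<omega>) (B i) < \<infinity>" by (auto intro: le_less_trans)
    from emeasure_point_measure_finite[OF measurable_space[OF xi \<omega>] B this]
    obtain k where "emeasure (\<xi> \<omega>) (B i) = of_nat k" ..
    then show "emeasure (\<xi> \<omega>) (B i) = of_nat (\<Delta> i \<omega>)"
      by (simp add: \<Delta>_def)
  qed
  have \<Delta>_meas [measurable]: "\<Delta> i \<in> measurable P (count_space UNIV)" for i
    unfolding \<Delta>_def by measurable
  have "prob {\<omega> \<in> space P. \<forall>i<n. \<Delta> i \<omega> = \<kappa> i} =
      (\<Prod>i<n. poisson_weight (increment (\<lambda>i. measure \<mu> {0..q i}) i) (\<kappa> i))" for \<kappa>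
  proof -
    have "prob {\<omega> \<in> space P. \<forall>i<n. \<Delta> i \<omega> = \<kappa> i} =
        prob {\<omega> \<in> space P. \<forall>i<n. emeasure (\<xi> \<omega>) (B i) = of_nat (\<kappa> i)}"
    proof (rule measure_eq_AE)
      show "AE \<omega> in P. (\<omega> \<in> {\<omega> \<in> space P. \<forall>i<n. \<Delta> i \<omega> = \<kappa> i}) =
          (\<omega> \<in> {\<omega> \<in> space P. \<forall>i<n. emeasure (\<xi> \<omega>) (B i) = of_nat (\<kappa> i)})"
        using \<Delta> by eventually_elim auto
    qed measurable
    also have "\<dots> = (\<Prod>i<n. prob {\<omega> \<in> space P. emeasure (\<xi> \<omega>) (B i) = of_nat (\<kappa> i)})"
    \<comment> \<open>For n = 0 the intersection over the cells would be the whole type instead of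
      \<open>space P\<close>.\<close>
    proof (cases "n = 0")
      case False
      have "indep_vars (\<lambda>_. borel) (\<lambda>i \<omega>. emeasure (\<xi> \<omega>) (B i)) {..<n}"
        using poi B disj by (auto simp: poisson_point_process_def)
      from indep_varsD_finite[OF this, of "\<lambda>i. {of_nat (\<kappa> i)}"] False
      have "prob (\<Inter>i<n. (\<lambda>\<omega>. emeasure (\<xi> \<omega>) (B i)) -` {of_nat (\<kappa> i)} \<inter> space P) =
          (\<Prod>i<n. prob ((\<lambda>\<omega>. emeasure (\<xi> \<omega>) (B i)) -` {of_nat (\<kappa> i)} \<inter> space P))"
        by auto
      moreover have "(\<Inter>i<n. (\<lambda>\<omega>. emeasure (\<xi> \<omega>) (B i)) -` {of_nat (\<kappa> i)} \<inter> space P) =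
          {\<omega> \<in> space P. \<forall>i<n. emeasure (\<xi> \<omega>) (B i) = of_nat (\<kappa> i)}"
        using False by auto
      moreover have "(\<lambda>\<omega>. emeasure (\<xi> \<omega>) (B i)) -` {of_nat (\<kappa> i)} \<inter> space P =
          {\<omega> \<in> space P. emeasure (\<xi> \<omega>) (B i) = of_nat (\<kappa> i)}" for i
        by auto
      ultimately show ?thesis by simp
    qed (simp add: prob_space)
    also have "\<dots> = (\<Prod>i<n. poisson_weight (increment (\<lambda>i. measure \<mu> {0..q i}) i) (\<kappa> i))"
    proof (rule prod.cong[OF refl])
      fix i assume "i \<in> {..<n}"
      then have "i < n" by simp
      with finB B poi have "prob {\<omega> \<in> space P. emeasure (\<xi> \<omega>) (B i) = of_nat (\<kappa> i)} =
          poisson_weight (measure \<mu> (B i)) (\<kappa> i)"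
        by (auto simp: poisson_point_process_def poisson_weight_def)
      then show "prob {\<omega> \<in> space P. emeasure (\<xi> \<omega>) (B i) = of_nat (\<kappa> i)} =
          poisson_weight (increment (\<lambda>i. measure \<mu> {0..q i}) i) (\<kappa> i)"
        using \<mu>B[OF \<open>i < n\<close>] by simp
    qed
    finally show ?thesis .
  qed
  moreover have "AE \<omega> in P. \<forall>i<n. emeasure (\<xi> \<omega>) {0..q i} = of_nat (\<Sum>j\<le>i. \<Delta> j \<omega>)"
    using \<Delta>
  proof (rule AE_mp, intro AE_I2 impI allI)
    fix \<omega> i assume \<omega>: "\<omega> \<in> space P" and f: "\<forall>i<n. emeasure (\<xi> \<omega>) (B i) = of_nat (\<Delta> i \<omega>)" and i: "i < n"
    have "emeasure (\<xi> \<omega>) {0..q i} = (\<Sum>j\<le>i. emeasure (\<xi> \<omega>) (B j))"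
      unfolding B_def using emeasure_atLeastAtMost_cells[OF sets_xi[OF \<omega>], of n q, OF mono nonneg i] .
    also have "\<dots> = (\<Sum>j\<le>i. of_nat (\<Delta> j \<omega>))"
      using f i by (intro sum.cong) auto
    finally show "emeasure (\<xi> \<omega>) {0..q i} = of_nat (\<Sum>j\<le>i. \<Delta> j \<omega>)" by simp
  qed
  ultimately show ?thesis
    unfolding increment_law_def by (intro exI[of _ \<Delta>]) auto
qed
section \<open>Coupling of the branching processes\<close>

lemma distr_PiM_componentwise:
  assumes N: "prob_space N" and f [measurable]: "f \<in> measurable N K" and "I \<noteq> {}"
  shows "distr (Pi\<^sub>M I (\<lambda>_. N)) (Pi\<^sub>M I (\<lambda>_. K)) (\<lambda>\<omega>. \<lambda>i\<in>I. f (\<omega> i)) = Pi\<^sub>M I (\<lambda>_. distr N K f)"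
proof -
  interpret prob_space "Pi\<^sub>M I (\<lambda>_. N)" by (intro prob_space_PiM N)
  have "indep_vars (\<lambda>_. N) (\<lambda>i \<omega>. \<omega> i) I"
    using assms(3) N by (intro indep_vars_PiM_component)
  then have "indep_vars (\<lambda>_. K) (\<lambda>i \<omega>. f (\<omega> i)) I"
    by (rule indep_vars_compose2) (rule f)
  then have "distr (Pi\<^sub>M I (\<lambda>_. N)) (Pi\<^sub>M I (\<lambda>_. K)) (\<lambda>\<omega>. \<lambda>i\<in>I. f (\<omega> i)) =
      Pi\<^sub>M I (\<lambda>i. distr (Pi\<^sub>M I (\<lambda>_. N)) K (\<lambda>\<omega>. f (\<omega> i)))"
    using assms(3) by (subst (asm) indep_vars_iff_distr_eq_PiM') auto
  also have "\<dots> = Pi\<^sub>M I (\<lambda>_. distr N K f)"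
  proof (rule PiM_cong[OF refl])
    fix i assume i: "i \<in> I"
    have "distr (Pi\<^sub>M I (\<lambda>_. N)) K (\<lambda>\<omega>. f (\<omega> i)) = distr (distr (Pi\<^sub>M I (\<lambda>_. N)) N (\<lambda>\<omega>. \<omega> i)) K f"
      using i by (subst distr_distr) (auto simp: comp_def)
    also have "distr (Pi\<^sub>M I (\<lambda>_. N)) N (\<lambda>\<omega>. \<omega> i) = N"
      using i N by (intro distr_PiM_component)
    finally show "distr (Pi\<^sub>M I (\<lambda>_. N)) K (\<lambda>\<omega>. f (\<omega> i)) = distr N K f" .
  qed
  finally show ?thesis .
qed

lemma labels_nonempty: "labels \<noteq> {}"
  using Nil_in_labels by blast

lemma iid_copies_measurable:
  assumes "iid_copies M \<Xi> P \<xi>" "u \<in> labels"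
  shows "\<Xi> u \<in> measurable M point_measures"
  using assms by (auto simp: iid_copies_def prob_space.indep_vars_def)

text \<open>Together with \<open>distr_PiM_componentwise\<close>, its counterpart for a product of
  samples, this reduces the comparison of two trees to that of single individuals.\<close>

lemma iid_copies_distr:
  assumes iid: "iid_copies M \<Xi> P \<xi>" and xi: "\<xi> \<in> measurable P point_measures"
    and g [measurable]: "g \<in> measurable point_measures N"
  shows "distr M (Pi\<^sub>M labels (\<lambda>_. N)) (\<lambda>\<omega>. \<lambda>u\<in>labels. g (\<Xi> u \<omega>)) =
    Pi\<^sub>M labels (\<lambda>_. distr P N (\<lambda>\<omega>. g (\<xi> \<omega>)))"
proof -
  interpret prob_space M using iid by (simp add: iid_copies_def)
  note [measurable] = iid_copies_measurable[OF iid] xi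
  have "indep_vars (\<lambda>_. point_measures) \<Xi> labels"
    using iid by (simp add: iid_copies_def)
  then have "indep_vars (\<lambda>_. N) (\<lambda>u \<omega>. g (\<Xi> u \<omega>)) labels"
    by (rule indep_vars_compose2) (rule g)
  then have "distr M (Pi\<^sub>M labels (\<lambda>_. N)) (\<lambda>\<omega>. \<lambda>u\<in>labels. g (\<Xi> u \<omega>)) =
      Pi\<^sub>M labels (\<lambda>u. distr M N (\<lambda>\<omega>. g (\<Xi> u \<omega>)))"
    using labels_nonempty by (subst (asm) indep_vars_iff_distr_eq_PiM') auto
  also have "\<dots> = Pi\<^sub>M labels (\<lambda>_. distr P N (\<lambda>\<omega>. g (\<xi> \<omega>)))"
  proof (rule PiM_cong[OF refl])
    fix u assume u: "u \<in> labels"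
    have "distr M N (\<lambda>\<omega>. g (\<Xi> u \<omega>)) = distr (distr M point_measures (\<Xi> u)) N g"
      using u by (subst distr_distr) (auto simp: comp_def)
    also have "distr M point_measures (\<Xi> u) = distr P point_measures \<xi>"
      using iid u by (simp add: iid_copies_def)
    also have "distr \<dots> N g = distr P N (\<lambda>\<omega>. g (\<xi> \<omega>))"
      by (subst distr_distr) (auto simp: comp_def)
    finally show "distr M N (\<lambda>\<omega>. g (\<Xi> u \<omega>)) = distr P N (\<lambda>\<omega>. g (\<xi> \<omega>))" .
  qed
  finally show ?thesis .
qed

section \<open>From the law of the counts to the law of the explosion time\<close>

lemma explosion_time_measurable:
  assumes "\<And>u. u \<in> labels \<Longrightarrow> X u \<in> measurable M point_measures"
  shows "Measurable.pred M (\<lambda>\<omega>. explosion_time (\<lambda>u. X u \<omega>) < ereal t)"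
  unfolding explosion_time_less_iff
  by (rule explodes_before_measurable) (rule measurable_compose[OF assms nth_point_measurable])

lemma explosion_time_finite_iff:
  "explosion_time x < \<infinity> \<longleftrightarrow> (\<exists>n. explosion_time x < ereal (real n))"
proof
  assume "explosion_time x < \<infinity>"
  then obtain r where "explosion_time x < ereal r"
    using ereal_dense2 by blast
  moreover obtain n where "r < real n" using reals_Archimedean2 by blast
  ultimately show "\<exists>n. explosion_time x < ereal (real n)"
    by (metis less_ereal.simps(1) less_trans)
qed auto

lemma explodes_before_cong:
  assumes "\<And>u j. u \<in> labels \<Longrightarrow> p u j = p' u j"
  shows "explodes_before p t \<longleftrightarrow> explodes_before p' t"
proof -
  have "birth p u = birth p' u" if "u \<in> labels" for u
    using that by (induction u) (auto simp: assms)
  then show ?thesis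
    unfolding explodes_before_def by (metis (mono_tags, lifting) Collect_cong)
qed

lemma count_point_cong: "(\<And>q. q \<in> Q \<Longrightarrow> c q = c' q) \<Longrightarrow> count_point Q c j = count_point Q c' j"
  unfolding count_point_def by (rule INF_cong) auto

text \<open>With infinite mean the Poisson count would be infinite almost surely, against local
  finiteness.\<close>

lemma intensity_finite:
  assumes "reproduction_point_process P \<xi>" "poisson_point_process P \<xi> \<mu>" "0 \<le> t"
  shows "emeasure \<mu> {0..t} < \<infinity>"
proof (rule ccontr)
  interpret prob_space P using assms(1) by (simp add: reproduction_point_process_def point_process_def)
  assume "\<not> emeasure \<mu> {0..t} < \<infinity>"
  then have "emeasure \<mu> {0..t} = \<infinity>" by (simp add: less_top[symmetric])
  then have "AE \<omega> in P. emeasure (\<xi> \<omega>) {0..t} = \<infinity>"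
    using assms(2) atLeastAtMost_in_half_line by (simp add: poisson_point_process_def)
  moreover have "AE \<omega> in P. emeasure (\<xi> \<omega>) {0..t} < \<infinity>"
    using assms(1,3) by (simp add: reproduction_point_process_def)
  ultimately have "AE \<omega> in P. False" by eventually_elim simp
  then show False by simp
qed

text \<open>Explosion before t \<le> t0 sees only points before \<open>t0\<close>, and these are
  determined by the counts at rational times below \<open>t0\<close>. For one individual, these
  counts have the law of the time-changed sample; independence over the labels extends this to the
  tree.\<close>

lemma prob_explosion_eq_sample:
  assumes rep: "reproduction_point_process P \<xi>" and poi: "poisson_point_process P \<xi> \<mu>"
    and iid: "iid_copies M \<Xi> P \<xi>" and m: "0 < m"
    and range: "\<And>q. 0 \<le> q \<Longrightarrow> q < t0 \<Longrightarrow> measure \<mu> {0..q} \<le> m" and "t \<le> t0"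
  shows "\<P>(\<omega> in M. cmj_explosion_time \<Xi> \<omega> < ereal t) =
    \<P>(\<omega> in Pi\<^sub>M labels (\<lambda>_. poisson_sample m (uniform_upto m)). explodes_before
      (\<lambda>u. count_point (rats_below t0) (\<lambda>q. of_nat (sample_count {..measure \<mu> {0..q}} (\<omega> u)))) t)"
proof -
  define Q where "Q = rats_below (ereal t0)"
  define \<Omega> where "\<Omega> = poisson_sample m (uniform_upto m)"
  define F where "F = (\<lambda>q. measure \<mu> {0..q})"
  define K where "K = Pi\<^sub>M Q (\<lambda>_. borel :: ennreal measure)"
  \<comment> \<open>The maps \<open>\<phi>\<close> and \<open>\<psi>\<close> send point measures and
    samples to the same space of counts, where \<open>H\<close> is one event for both.\<close>
  define \<phi> where "\<phi> = (\<lambda>\<nu>. \<lambda>q\<in>Q. emeasure \<nu> {0..q})"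
  define \<psi> :: "nat \<times> (nat \<Rightarrow> real) \<Rightarrow> real \<Rightarrow> ennreal"
    where "\<psi> = (\<lambda>\<omega>. \<lambda>q\<in>Q. of_nat (sample_count {..F q} \<omega>))"
  define H where "H = {c \<in> space (Pi\<^sub>M labels (\<lambda>_. K)). explodes_before (\<lambda>u. count_point Q (c u)) t}"
  have \<Omega>: "prob_space \<Omega>"
    unfolding \<Omega>_def by (intro prob_space_poisson_sample prob_space_uniform_upto m)
  have P: "prob_space P" and xi [measurable]: "\<xi> \<in> measurable P point_measures"
    using rep by (auto simp: reproduction_point_process_def point_process_def)
  have Q: "countable Q" "Q \<subseteq> {0..}"
    unfolding Q_def by (rule countable_rats_below) auto
  have \<phi> [measurable]: "\<phi> \<in> measurable point_measures K"
    unfolding \<phi>_def K_def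
    by (intro measurable_restrict measurable_emeasure_point_measures atLeastAtMost_in_half_line)
  have count_\<Omega> [measurable]: "(\<lambda>\<omega>. of_nat (sample_count {..F q} \<omega>) :: ennreal) \<in> borel_measurable \<Omega>" for q
  proof -
    have "sample_count {..F q} \<in> measurable \<Omega> (count_space UNIV)"
      unfolding \<Omega>_def by (intro sample_count_measurable) simp
    then show ?thesis by (rule measurable_compose) simp
  qed
  have \<psi> [measurable]: "\<psi> \<in> measurable \<Omega> K"
    unfolding \<psi>_def K_def by (intro measurable_restrict count_\<Omega>)
  have H [measurable]: "H \<in> sets (Pi\<^sub>M labels (\<lambda>_. K))"
  proof -
    have "(\<lambda>c. c u q) \<in> borel_measurable (Pi\<^sub>M labels (\<lambda>_. K))" if "u \<in> labels" "q \<in> Q" for u q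
    proof -
      have "(\<lambda>c. c u) \<in> measurable (Pi\<^sub>M labels (\<lambda>_. K)) K"
        using that(1) by (rule measurable_component_singleton)
      moreover have "(\<lambda>d. d q) \<in> borel_measurable K"
        unfolding K_def using that(2) by (rule measurable_component_singleton)
      ultimately show ?thesis by (rule measurable_compose)
    qed
    then have "Measurable.pred (Pi\<^sub>M labels (\<lambda>_. K)) (\<lambda>c. explodes_before (\<lambda>u. count_point Q (c u)) t)"
      using Q(1) by (intro explodes_before_measurable count_point_measurable)
    then show ?thesis unfolding H_def by measurable
  qed
  have \<Xi> [measurable]: "(\<lambda>\<omega>. \<lambda>u\<in>labels. \<phi> (\<Xi> u \<omega>)) \<in> measurable M (Pi\<^sub>M labels (\<lambda>_. K))"
    by (intro measurable_restrict measurable_compose[OF iid_copies_measurable[OF iid] \<phi>])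
  have \<psi>\<^sub>u [measurable]: "(\<lambda>\<omega>. \<lambda>u\<in>labels. \<psi> (\<omega> u)) \<in> measurable (Pi\<^sub>M labels (\<lambda>_. \<Omega>)) (Pi\<^sub>M labels (\<lambda>_. K))"
  proof (rule measurable_restrict)
    fix u assume "u \<in> labels"
    then have "(\<lambda>\<omega>. \<omega> u) \<in> measurable (Pi\<^sub>M labels (\<lambda>_. \<Omega>)) \<Omega>"
      by (rule measurable_component_singleton)
    then show "(\<lambda>\<omega>. \<psi> (\<omega> u)) \<in> measurable (Pi\<^sub>M labels (\<lambda>_. \<Omega>)) K"
      by (rule measurable_compose[OF _ \<psi>])
  qed
  have law: "distr P K (\<lambda>\<omega>. \<phi> (\<xi> \<omega>)) = distr \<Omega> K \<psi>"
    unfolding K_def \<phi>_def \<psi>_def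
  proof (rule distr_eq_of_increment_laws[OF P \<Omega>])
    show "(\<lambda>\<omega>. emeasure (\<xi> \<omega>) {0..q}) \<in> borel_measurable P" for q
      by (rule measurable_compose[OF xi measurable_emeasure_point_measures[OF atLeastAtMost_in_half_line]])
    fix n and q :: "nat \<Rightarrow> real" assume qQ: "\<And>i. i < n \<Longrightarrow> q i \<in> Q" and less: "\<And>i j. i < j \<Longrightarrow> j < n \<Longrightarrow> q i < q j"
    have mono: "q i \<le> q j" if "i \<le> j" "j < n" for i j
      using less[of i j] that by (cases "i = j") auto
    have nonneg: "0 \<le> q i" "q i < t0" if "i < n" for i
      using qQ[OF that] by (auto simp: Q_def)
    have fin: "emeasure \<mu> {0..q i} < \<infinity>" if "i < n" for i
      by (rule intensity_finite[OF rep poi nonneg(1)[OF that]])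
    have sets_\<mu>: "sets \<mu> = sets half_line"
      by (rule sets_poisson_intensity[OF poi])
    have "F (q i) \<le> F (q j)" if "i \<le> j" "j < n" for i j
      unfolding F_def using fin[OF that(2)] mono[OF that] atLeastAtMost_in_half_line
      by (intro measure_mono_fmeasurable) (auto simp: fmeasurable_def sets_\<mu>)
    then have "increment_law \<Omega> (\<lambda>\<omega> t. of_nat (sample_count {..F t} \<omega>)) n q
        (\<lambda>\<kappa>. \<Prod>i<n. poisson_weight (increment (\<lambda>i. F (q i)) i) (\<kappa> i))"
      unfolding \<Omega>_def using nonneg range by (intro increment_law_sample m) (auto simp: F_def)
    moreover have "increment_law P (\<lambda>\<omega> t. emeasure (\<xi> \<omega>) {0..t}) n q
        (\<lambda>\<kappa>. \<Prod>i<n. poisson_weight (increment (\<lambda>i. F (q i)) i) (\<kappa> i))"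
      unfolding F_def by (rule increment_law_poisson_point_process[OF rep poi fin mono nonneg(1)])
    ultimately show "\<exists>w. increment_law P (\<lambda>\<omega> q. emeasure (\<xi> \<omega>) {0..q}) n q w \<and>
        increment_law \<Omega> (\<lambda>\<omega> q. of_nat (sample_count {..F q} \<omega>)) n q w" by blast
  qed (rule count_\<Omega>)
  have "explosion_time (\<lambda>u. \<Xi> u \<omega>) < ereal t \<longleftrightarrow> (\<lambda>u\<in>labels. \<phi> (\<Xi> u \<omega>)) \<in> H" if \<omega>: "\<omega> \<in> space M" for \<omega>
  proof -
    have pm: "\<Xi> u \<omega> \<in> space point_measures" if "u \<in> labels" for u
      using measurable_space[OF iid_copies_measurable[OF iid that] \<omega>] .
    let ?c = "\<lambda>u. count_point Q (\<lambda>q. emeasure (\<Xi> u \<omega>) {0..q})"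
    \<comment> \<open>The position \<open>count_point\<close> is never earlier than
      \<open>nth_point\<close>, and equal to it where the latter lies below \<open>t0\<close>. Hence
      the monotonicity of explosion applies in both directions.\<close>
    have "explodes_before (\<lambda>u. nth_point (\<Xi> u \<omega>)) t \<longleftrightarrow> explodes_before ?c t"
    proof
      show "explodes_before ?c t" if "explodes_before (\<lambda>u. nth_point (\<Xi> u \<omega>)) t"
        unfolding Q_def
        by (rule explodes_before_mono[OF nth_point_nonneg count_point_le_nth_point[OF pm] assms(6) that])
      show "explodes_before (\<lambda>u. nth_point (\<Xi> u \<omega>)) t" if "explodes_before ?c t"
        using that unfolding Q_def
        by (rule explodes_before_mono[OF _ nth_point_le_count_point assms(6), rotated -1])
           (rule count_point_nonneg, auto)
    qed
    also have "explodes_before ?c t \<longleftrightarrow> explodes_before (\<lambda>u. count_point Q ((\<lambda>u\<in>labels. \<phi> (\<Xi> u \<omega>)) u)) t"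
      by (intro explodes_before_cong count_point_cong) (simp add: \<phi>_def)
    finally show ?thesis
      using measurable_space[OF \<Xi> \<omega>] by (simp add: explosion_time_less_iff H_def)
  qed
  then have "\<P>(\<omega> in M. cmj_explosion_time \<Xi> \<omega> < ereal t) =
      measure (distr M (Pi\<^sub>M labels (\<lambda>_. K)) (\<lambda>\<omega>. \<lambda>u\<in>labels. \<phi> (\<Xi> u \<omega>))) H"
    by (subst measure_distr[OF \<Xi> H]) (auto intro!: arg_cong[where f="measure M"])
  also have "distr M (Pi\<^sub>M labels (\<lambda>_. K)) (\<lambda>\<omega>. \<lambda>u\<in>labels. \<phi> (\<Xi> u \<omega>)) =
      distr (Pi\<^sub>M labels (\<lambda>_. \<Omega>)) (Pi\<^sub>M labels (\<lambda>_. K)) (\<lambda>\<omega>. \<lambda>u\<in>labels. \<psi> (\<omega> u))"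
    by (simp add: iid_copies_distr[OF iid xi \<phi>] law distr_PiM_componentwise[OF \<Omega> \<psi> labels_nonempty])
  also have "measure \<dots> H = \<P>(\<omega> in Pi\<^sub>M labels (\<lambda>_. \<Omega>). explodes_before
      (\<lambda>u. count_point Q (\<lambda>q. of_nat (sample_count {..F q} (\<omega> u)))) t)"
  proof (subst measure_distr[OF \<psi>\<^sub>u H], rule arg_cong[where f="measure (Pi\<^sub>M labels (\<lambda>_. \<Omega>))"])
    have "explodes_before (\<lambda>u. count_point Q ((\<lambda>u\<in>labels. \<psi> (\<omega> u)) u)) t \<longleftrightarrow>
        explodes_before (\<lambda>u. count_point Q (\<lambda>q. of_nat (sample_count {..F q} (\<omega> u)))) t" for \<omega>
      by (intro explodes_before_cong count_point_cong) (simp add: \<psi>_def)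
    then show "(\<lambda>\<omega>. \<lambda>u\<in>labels. \<psi> (\<omega> u)) -` H \<inter> space (Pi\<^sub>M labels (\<lambda>_. \<Omega>)) =
        {\<omega> \<in> space (Pi\<^sub>M labels (\<lambda>_. \<Omega>)). explodes_before
          (\<lambda>u. count_point Q (\<lambda>q. of_nat (sample_count {..F q} (\<omega> u)))) t}"
      using measurable_space[OF \<psi>\<^sub>u] by (auto simp: H_def)
  qed
  finally show ?thesis by (simp only: \<Omega>_def Q_def F_def)
qed

lemma prob_explosion_mono:
  assumes rep: "reproduction_point_process P \<xi>" "reproduction_point_process P' \<xi>'"
    and poi: "poisson_point_process P \<xi> \<mu>" "poisson_point_process P' \<xi>' \<mu>'"
    and iid: "iid_copies M \<Xi> P \<xi>" "iid_copies M' \<Xi>' P' \<xi>'"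
    and "0 < t0" and le: "\<And>t. t \<le> t0 \<Longrightarrow> emeasure \<mu> {0..t} \<le> emeasure \<mu>' {0..t}" and t: "t \<le> t0"
  shows "\<P>(\<omega> in M. cmj_explosion_time \<Xi> \<omega> < ereal t) \<le> \<P>(\<omega> in M'. cmj_explosion_time \<Xi>' \<omega> < ereal t)"
proof -
  \<comment> \<open>A common bound for all levels in use; the summand 1 keeps it positive, as the
    uniform law on [0,m] requires, when \<mu>' has no mass on [0,t0].\<close>
  define m where "m = measure \<mu>' {0..t0} + 1"
  define \<Omega> where "\<Omega> = poisson_sample m (uniform_upto m)"
  have m: "0 < m" by (simp add: m_def add_nonneg_pos)
  interpret \<Omega>: prob_space "Pi\<^sub>M labels (\<lambda>_. \<Omega>)"
    unfolding \<Omega>_def by (intro prob_space_PiM prob_space_poisson_sample prob_space_uniform_upto m)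
  have fin: "emeasure \<mu>' {0..q} < \<infinity>" if "0 \<le> q" for q
    by (rule intensity_finite[OF rep(2) poi(2) that])
  have sets_\<mu>': "sets \<mu>' = sets half_line"
    by (rule sets_poisson_intensity[OF poi(2)])
  have F': "measure \<mu>' {0..q} \<le> m" if "0 \<le> q" "q < t0" for q
  proof -
    have "measure \<mu>' {0..q} \<le> measure \<mu>' {0..t0}"
      using that fin[of t0] atLeastAtMost_in_half_line
      by (intro measure_mono_fmeasurable) (auto simp: fmeasurable_def sets_\<mu>')
    then show ?thesis by (simp add: m_def)
  qed
  have FF': "measure \<mu> {0..q} \<le> measure \<mu>' {0..q}" if "0 \<le> q" "q < t0" for q
    unfolding measure_def using le[of q] fin[of q] that by (intro enn2real_mono) auto
  have F: "measure \<mu> {0..q} \<le> m" if "0 \<le> q" "q < t0" for q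
    using FF'[OF that] F'[OF that] by (rule order_trans)
  \<comment> \<open>Both trees are read off from the same samples \<open>\<omega>\<close>: the
    higher level of \<mu>' collects at least as many sample points by each time, so every child
    comes no later.\<close>
  let ?c = "\<lambda>\<mu> \<omega> u. count_point (rats_below t0) (\<lambda>q. of_nat (sample_count {..measure \<mu> {0..q}} (\<omega> u)))"
  have "explodes_before (?c \<mu>' \<omega>) t" if "explodes_before (?c \<mu> \<omega>) t" for \<omega>
  proof (rule explodes_before_mono[OF _ _ t that])
    show "0 \<le> ?c \<mu> \<omega> u j" for u j by (rule count_point_nonneg) auto
    show "?c \<mu>' \<omega> u j \<le> ?c \<mu> \<omega> u j" for u j
      using FF' by (intro count_point_antimono) (auto simp: sample_count_def intro!: point_count_mono)
  qed
  moreover have "{\<omega> \<in> space (Pi\<^sub>M labels (\<lambda>_. \<Omega>)). explodes_before (?c \<mu>' \<omega>) t} \<in> \<Omega>.events"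
  proof -
    have [measurable]: "(\<lambda>\<omega>. of_nat (sample_count {..measure \<mu>' {0..q}} (\<omega> u)) :: ennreal)
        \<in> borel_measurable (Pi\<^sub>M labels (\<lambda>_. \<Omega>))" if u: "u \<in> labels" for u q
    proof -
      have "sample_count {..measure \<mu>' {0..q}} \<in> measurable \<Omega> (count_space UNIV)"
        unfolding \<Omega>_def by (intro sample_count_measurable) simp
      from measurable_compose[OF measurable_component_singleton[OF u] this]
      show ?thesis by (rule measurable_compose) simp
    qed
    have "Measurable.pred (Pi\<^sub>M labels (\<lambda>_. \<Omega>)) (\<lambda>\<omega>. explodes_before (?c \<mu>' \<omega>) t)"
      by (intro explodes_before_measurable count_point_measurable countable_rats_below) measurable
    then show ?thesis by measurable
  qed
  ultimately have "\<Omega>.prob {\<omega> \<in> space (Pi\<^sub>M labels (\<lambda>_. \<Omega>)). explodes_before (?c \<mu> \<omega>) t} \<le>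
      \<Omega>.prob {\<omega> \<in> space (Pi\<^sub>M labels (\<lambda>_. \<Omega>)). explodes_before (?c \<mu>' \<omega>) t}"
    by (intro \<Omega>.finite_measure_mono) auto
  moreover have "\<P>(\<omega> in M. cmj_explosion_time \<Xi> \<omega> < ereal t) =
      \<Omega>.prob {\<omega> \<in> space (Pi\<^sub>M labels (\<lambda>_. \<Omega>)). explodes_before (?c \<mu> \<omega>) t}"
    unfolding \<Omega>_def by (rule prob_explosion_eq_sample[OF rep(1) poi(1) iid(1) m F t])
  moreover have "\<P>(\<omega> in M'. cmj_explosion_time \<Xi>' \<omega> < ereal t) =
      \<Omega>.prob {\<omega> \<in> space (Pi\<^sub>M labels (\<lambda>_. \<Omega>)). explodes_before (?c \<mu>' \<omega>) t}"
    unfolding \<Omega>_def by (rule prob_explosion_eq_sample[OF rep(2) poi(2) iid(2) m F' t])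
  ultimately show ?thesis by (simp only:)
qed

text \<open>With the youngest generation first, the descendants of \<open>w\<close> are the labels
  \<open>u @ w\<close>. Appending \<open>w\<close> maps the labels injectively into themselves, and
  a product of identical laws is invariant under reindexing along an injection.\<close>

lemma prob_explosion_subtree:
  assumes iid: "iid_copies M \<Xi> P \<xi>" and xi: "\<xi> \<in> measurable P point_measures" and P: "prob_space P"
    and w: "w \<in> labels"
  shows "\<P>(\<omega> in M. cmj_explosion_time (\<lambda>u. \<Xi> (u @ w)) \<omega> < ereal t) =
    \<P>(\<omega> in M. cmj_explosion_time \<Xi> \<omega> < ereal t)"
proof -
  define D where "D = distr P point_measures \<xi>"
  define L where "L = Pi\<^sub>M labels (\<lambda>_. point_measures)"
  define G where "G = {x \<in> space L. explosion_time x < ereal t}"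
  have D: "prob_space D" unfolding D_def using xi by (rule prob_space.prob_space_distr[OF P])
  note X = iid_copies_measurable[OF iid]
  have G: "G \<in> sets L"
  proof -
    have "Measurable.pred L (\<lambda>x. explosion_time (\<lambda>u. x u) < ereal t)"
      unfolding L_def by (intro explosion_time_measurable measurable_component_singleton)
    then show ?thesis unfolding G_def by simp
  qed
  have eq: "\<P>(\<omega> in M. cmj_explosion_time Y \<omega> < ereal t) = measure (distr M L (\<lambda>\<omega>. \<lambda>u\<in>labels. Y u \<omega>)) G"
    if Y: "\<And>u. u \<in> labels \<Longrightarrow> Y u \<in> measurable M point_measures" for Y
  proof -
    have m: "(\<lambda>\<omega>. \<lambda>u\<in>labels. Y u \<omega>) \<in> measurable M L"
      unfolding L_def by (intro measurable_restrict Y)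
    have "explosion_time (\<lambda>u\<in>labels. Y u \<omega>) < ereal t \<longleftrightarrow> explosion_time (\<lambda>u. Y u \<omega>) < ereal t" for \<omega>
      unfolding explosion_time_less_iff by (intro explodes_before_cong) simp
    then show ?thesis
      using measurable_space[OF m]
      by (subst measure_distr[OF m G]) (auto intro!: arg_cong[where f="measure M"] simp: G_def)
  qed
  have "distr M L (\<lambda>\<omega>. \<lambda>u\<in>labels. \<Xi> (u @ w) \<omega>) =
      distr (distr M L (\<lambda>\<omega>. \<lambda>u\<in>labels. \<Xi> u \<omega>)) L (\<lambda>x. \<lambda>u\<in>labels. x (u @ w))"
  proof (subst distr_distr)
    show "(\<lambda>x. \<lambda>u\<in>labels. x (u @ w)) \<in> measurable L L"
      unfolding L_def using w by (intro measurable_restrict measurable_component_singleton) simp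
    show "(\<lambda>\<omega>. \<lambda>u\<in>labels. \<Xi> u \<omega>) \<in> measurable M L"
      unfolding L_def by (intro measurable_restrict X)
    show "distr M L (\<lambda>\<omega>. \<lambda>u\<in>labels. \<Xi> (u @ w) \<omega>) =
        distr M L ((\<lambda>x. \<lambda>u\<in>labels. x (u @ w)) \<circ> (\<lambda>\<omega>. \<lambda>u\<in>labels. \<Xi> u \<omega>))"
      using w by (intro distr_cong) (auto simp: fun_eq_iff)
  qed
  also have law: "distr M L (\<lambda>\<omega>. \<lambda>u\<in>labels. \<Xi> u \<omega>) = Pi\<^sub>M labels (\<lambda>_. D)"
    unfolding L_def D_def by (rule iid_copies_distr[OF iid xi]) simp
  also have "distr \<dots> L (\<lambda>x. \<lambda>u\<in>labels. x (u @ w)) =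
      distr (Pi\<^sub>M labels (\<lambda>_. D)) (Pi\<^sub>M labels (\<lambda>_. D)) (\<lambda>x. \<lambda>u\<in>labels. x (u @ w))"
    by (rule distr_cong) (auto simp: L_def D_def intro!: sets_PiM_cong)
  also have "\<dots> = Pi\<^sub>M labels (\<lambda>_. D)"
    using w D by (intro distr_PiM_reindex[where f="\<lambda>u. u @ w" and M="\<lambda>_. D"]) (auto simp: inj_on_def)
  finally have "distr M L (\<lambda>\<omega>. \<lambda>u\<in>labels. \<Xi> (u @ w) \<omega>) = Pi\<^sub>M labels (\<lambda>_. D)" .
  then show ?thesis
    using eq[of \<Xi>, OF X] eq[of "\<lambda>u. \<Xi> (u @ w)"] X w by (simp add: law)
qed

lemma prob_explosion_finite_eq_0:
  assumes rep: "reproduction_point_process P \<xi>" and iid: "iid_copies M \<Xi> P \<xi>" and t: "0 < t"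
    and zero: "\<P>(\<omega> in M. cmj_explosion_time \<Xi> \<omega> < ereal t) = 0"
  shows "\<P>(\<omega> in M. cmj_explosion_time \<Xi> \<omega> < \<infinity>) = 0"
proof -
  interpret prob_space M using iid by (simp add: iid_copies_def)
  have P: "prob_space P" and xi: "\<xi> \<in> measurable P point_measures"
    using rep by (auto simp: reproduction_point_process_def point_process_def)
  note X = iid_copies_measurable[OF iid]
  have countable: "countable labels" by (rule countableI_type)
  have "AE \<omega> in M. \<forall>w\<in>labels. \<not> explosion_time (\<lambda>u. \<Xi> (u @ w) \<omega>) < ereal t"
  proof (subst AE_ball_countable[OF countable], intro ballI)
    fix w assume w: "w \<in> labels"
    have "prob {\<omega> \<in> space M. explosion_time (\<lambda>u. \<Xi> (u @ w) \<omega>) < ereal t} = 0"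
      using prob_explosion_subtree[OF iid xi P w] zero by simp
    moreover have "Measurable.pred M (\<lambda>\<omega>. explosion_time (\<lambda>u. \<Xi> (u @ w) \<omega>) < ereal t)"
      using w by (intro explosion_time_measurable X) simp
    ultimately show "AE \<omega> in M. \<not> explosion_time (\<lambda>u. \<Xi> (u @ w) \<omega>) < ereal t"
      by (subst (asm) prob_eq_0) (auto elim: AE_mp)
  qed
  \<comment> \<open>Local finiteness passes from \<open>\<xi>\<close> to each label through the
    common law. Integer times keep the exceptional null sets countable in number.\<close>
  moreover have "AE \<omega> in M. \<forall>w\<in>labels. \<forall>n::nat. emeasure (\<Xi> w \<omega>) {0..real n} < \<infinity>"
  proof (subst AE_ball_countable[OF countable], intro ballI, subst AE_all_countable, intro allI)
    fix w and n :: nat assume w: "w \<in> labels"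
    have S: "{\<nu> \<in> space point_measures. emeasure \<nu> {0..real n} < \<infinity>} \<in> sets point_measures"
      using measurable_emeasure_point_measures[OF atLeastAtMost_in_half_line, of "real n"] by measurable
    have "AE \<omega> in P. emeasure (\<xi> \<omega>) {0..real n} < \<infinity>"
      using rep by (simp add: reproduction_point_process_def)
    then have "AE \<nu> in distr P point_measures \<xi>. emeasure \<nu> {0..real n} < \<infinity>"
      by (subst AE_distr_iff[OF xi S])
    also have "distr P point_measures \<xi> = distr M point_measures (\<Xi> w)"
      using iid w by (simp add: iid_copies_def)
    finally show "AE \<omega> in M. emeasure (\<Xi> w \<omega>) {0..real n} < \<infinity>"
      by (subst (asm) AE_distr_iff[OF X[OF w] S])
  qed
  ultimately have "AE \<omega> in M. \<not> explosion_time (\<lambda>u. \<Xi> u \<omega>) < \<infinity>"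
  proof (rule AE_mp[OF AE_conjI], intro AE_I2 impI notI, elim conjE)
    fix \<omega> assume \<omega>: "\<omega> \<in> space M" and sub: "\<forall>w\<in>labels. \<not> explosion_time (\<lambda>u. \<Xi> (u @ w) \<omega>) < ereal t"
      and loc: "\<forall>w\<in>labels. \<forall>n::nat. emeasure (\<Xi> w \<omega>) {0..real n} < \<infinity>"
      and expl: "explosion_time (\<lambda>u. \<Xi> u \<omega>) < \<infinity>"
    have fin_sub: "finite (born_by (\<lambda>v. \<Xi> (v @ w) \<omega>) (t / 2))" if "w \<in> labels" for w
    proof -
      \<comment> \<open>T \<ge> t yields finiteness only at ages strictly below t, hence steps of
        length t / 2.\<close>
      have "t / 2 < t" using t by simp
      with sub that show ?thesis
        unfolding explosion_time_less_iff explodes_before_def born_by_def birth_time_eq_birth by blast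
    qed
    have fin_loc: "finite {j. nth_point (\<Xi> w \<omega>) j \<le> ereal r}" if "w \<in> labels" for w r
      using loc that measurable_space[OF X[OF that] \<omega>] by (intro finite_nth_point_le) auto
    have fin: "finite (born_by (\<lambda>v. \<Xi> v \<omega>) (real n * (t / 2)))" for n
      using finite_born_by_multiple[of "t / 2" "\<lambda>v. \<Xi> v \<omega>" "[]" n] fin_sub fin_loc t by simp
    obtain s where s: "infinite (born_by (\<lambda>v. \<Xi> v \<omega>) s)"
      using expl unfolding explosion_time_def Inf_less_iff by auto
    obtain n :: nat where n: "s / (t / 2) < real n" using reals_Archimedean2 by blast
    then have "s \<le> real n * (t / 2)" using t by (simp add: field_simps)
    then have "born_by (\<lambda>v. \<Xi> v \<omega>) s \<subseteq> born_by (\<lambda>v. \<Xi> v \<omega>) (real n * (t / 2))"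
      by (auto simp: born_by_def intro: order_trans)
    with fin s show False by (meson finite_subset)
  qed
  then have "AE \<omega> in M. \<omega> \<notin> {\<omega> \<in> space M. explosion_time (\<lambda>u. \<Xi> u \<omega>) < \<infinity>}"
    by eventually_elim auto
  moreover have "{\<omega> \<in> space M. explosion_time (\<lambda>u. \<Xi> u \<omega>) < \<infinity>} \<in> events"
  proof -
    note [measurable] = explosion_time_measurable[of \<Xi>, OF X]
    show ?thesis unfolding explosion_time_finite_iff by measurable
  qed
  ultimately show ?thesis by (subst prob_eq_0) auto
qed

theorem proposition5p3:
  fixes P :: "'a measure" and \<xi> :: "'a \<Rightarrow> real measure" and \<mu> :: "real measure"
    and P' :: "'b measure" and \<xi>' :: "'b \<Rightarrow> real measure" and \<mu>' :: "real measure"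
    and M :: "'c measure" and \<Xi> :: "nat list \<Rightarrow> 'c \<Rightarrow> real measure"
    and M' :: "'d measure" and \<Xi>' :: "nat list \<Rightarrow> 'd \<Rightarrow> real measure"
    and t0 :: real
  assumes "reproduction_point_process P \<xi>" and "poisson_point_process P \<xi> \<mu>"
    and "reproduction_point_process P' \<xi>'" and "poisson_point_process P' \<xi>' \<mu>'"
    and "t0 > 0" and "\<And>t. t \<le> t0 \<Longrightarrow> emeasure \<mu> {0..t} \<le> emeasure \<mu>' {0..t}"
    and "iid_copies M \<Xi> P \<xi>" and "iid_copies M' \<Xi>' P' \<xi>'"
  shows "(explosive_cmj M \<Xi> \<longrightarrow> explosive_cmj M' \<Xi>') \<and>
    (\<forall>t\<le>t0. \<P>(\<omega> in M. cmj_explosion_time \<Xi> \<omega> \<ge> ereal t)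
            \<ge> \<P>(\<omega> in M'. cmj_explosion_time \<Xi>' \<omega> \<ge> ereal t))"
proof -
  interpret M: prob_space M using assms(7) by (simp add: iid_copies_def)
  interpret M': prob_space M' using assms(8) by (simp add: iid_copies_def)
  have less_le: "\<P>(\<omega> in M. cmj_explosion_time \<Xi> \<omega> < ereal t) \<le> \<P>(\<omega> in M'. cmj_explosion_time \<Xi>' \<omega> < ereal t)"
    if "t \<le> t0" for t
    by (rule prob_explosion_mono[OF assms(1,3,2,4,7,8,5,6) that])
  note [measurable] =
    explosion_time_measurable[of \<Xi>, OF iid_copies_measurable[OF assms(7)]]
    explosion_time_measurable[of \<Xi>', OF iid_copies_measurable[OF assms(8)]]
  have "explosive_cmj M' \<Xi>'" if "explosive_cmj M \<Xi>"
  proof -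
    \<comment> \<open>Were this probability 0, there would almost surely be no explosion at any
      finite time.\<close>
    have "\<P>(\<omega> in M. cmj_explosion_time \<Xi> \<omega> < ereal t0) \<noteq> 0"
      using prob_explosion_finite_eq_0[OF assms(1,7,5)] that by (auto simp: explosive_cmj_def)
    then have "0 < \<P>(\<omega> in M. cmj_explosion_time \<Xi> \<omega> < ereal t0)"
      by (simp add: zero_less_measure_iff)
    also note less_le[OF order_refl]
    also have "\<P>(\<omega> in M'. cmj_explosion_time \<Xi>' \<omega> < ereal t0) \<le> \<P>(\<omega> in M'. cmj_explosion_time \<Xi>' \<omega> < \<infinity>)"
    proof (rule M'.finite_measure_mono)
      show "{\<omega> \<in> space M'. cmj_explosion_time \<Xi>' \<omega> < \<infinity>} \<in> M'.events"
        unfolding explosion_time_finite_iff by measurable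
    qed (auto intro: less_trans)
    finally show ?thesis by (simp add: explosive_cmj_def)
  qed
  \<comment> \<open>T \<ge> t is the complement of T < t, which reverses the inequality.\<close>
  moreover have "\<P>(\<omega> in M. cmj_explosion_time \<Xi> \<omega> \<ge> ereal t) \<ge> \<P>(\<omega> in M'. cmj_explosion_time \<Xi>' \<omega> \<ge> ereal t)"
    if "t \<le> t0" for t
    using less_le[OF that] M.prob_neg[of "\<lambda>\<omega>. cmj_explosion_time \<Xi> \<omega> < ereal t"]
      M'.prob_neg[of "\<lambda>\<omega>. cmj_explosion_time \<Xi>' \<omega> < ereal t"]
    by (simp add: not_less)
  ultimately show ?thesis by blast
qed

end
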